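(* Let $\Sigma^+_t=\mathrm{diag}(F^+_t)+A\,\mathrm{diag}(V^+_t)\,A'$, with entries $\sigma_t^{kj+}$, be the integrated covariance process described in the context, where $F$ and $V$ are Ornstein–Uhlenbeck processes with deterministic initial values $F_0,V_0$ driven by independent Inverse Gaussian subordinators. For $t>0$, $H\in\{F,V\}$, $l=1,2$ put $$D_{H,l}=\frac{i\,a_{H,l}}{\lambda_{H,l}b_{H,l}}\big(\lambda_{H,l}t-(1-e^{-\lambda_{H,l}t})\big),$$ $$D^{2}_{H,l}=-\frac{a_{H,l}}{\lambda_{H,l}^2b_{H,l}^3}\Big[\lambda_{H,l}t-2(1-e^{-\lambda_{H,l}t})+\tfrac12(1-e^{-2\lambda_{H,l}t})\Big]$$ (here $D^2_{H,l}$ is a single symbol, not a square), and $$\phi_k=\lambda_{F,k}^{-1}(1-e^{-\lambda_{F,k}t})F_0^{(k)},\qquad \nu_l=\lambda_{V,l}^{-1}(1-e^{-\lambda_{V,l}t})V_0^{(l)}.$$ Then the first two moments of the entries of $\Sigma_t^+$ are, for $k=1,2$, $$E_{\mathcal{Q}}(\sigma_t^{kk+})=\phi_k-iD_{F,k}+\sum_{l=1}^2a_{kl}^2\nu_l-i\sum_{l=1}^2a_{kl}^2D_{V,l},$$ $$E_{\mathcal{Q}}(\sigma_t^{12+})=\sum_{l=1}^2a_{1l}a_{2l}\nu_l-i\sum_{l=1}^2a_{1l}a_{2l}D_{V,l},$$ $$E_{\mathcal{Q}}[(\sigma_t^{kk+})^2]=-\Big(i\phi_k+D_{F,k}+i\sum_{l=1}^2a_{kl}^2\nu_l+\sum_{l=1}^2a_{kl}^2D_{V,l}\Big)^2-\Big(D^2_{F,k}+\sum_{l=1}^2a_{kl}^4D^2_{V,l}\Big),$$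 $$E_{\mathcal{Q}}[(\sigma_t^{12+})^2]=-\sum_{l=1}^2a_{1l}^2a_{2l}^2D^2_{V,l}-\Big(i\sum_{l=1}^2a_{1l}a_{2l}\nu_l+\sum_{l=1}^2a_{1l}a_{2l}D_{V,l}\Big)^2,$$ $$E_{\mathcal{Q}}(\sigma_t^{kk+}\sigma_t^{12+})=-\sum_{l=1}^2a_{kl}^2a_{1l}a_{2l}D^2_{V,l}-\Big(i\phi_k+D_{F,k}+i\sum_{l=1}^2a_{kl}^2\nu_l+\sum_{l=1}^2a_{kl}^2D_{V,l}\Big)\Big(i\sum_{l=1}^2a_{1l}a_{2l}\nu_l+\sum_{l=1}^2a_{1l}a_{2l}D_{V,l}\Big),$$ $$E_{\mathcal{Q}}(\sigma_t^{11+}\sigma_t^{22+})=-\sum_{l=1}^2a_{1l}^2a_{2l}^2D^2_{V,l}-\Big(i\phi_1+D_{F,1}+i\sum_{l=1}^2a_{1l}^2\nu_l+\sum_{l=1}^2a_{1l}^2D_{V,l}\Big)\Big(i\phi_2+D_{F,2}+i\sum_{l=1}^2a_{2l}^2\nu_l+\sum_{l=1}^2a_{2l}^2D_{V,l}\Big).$$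
   Context: All laws and expectations are under a probability measure $\mathcal{Q}$; $i$ is the imaginary unit. For $H\in\{F,V\}$ and $l\in\{1,2\}$ let $\lambda_{H,l}>0$, $a_{H,l}>0$, $b_{H,l}>0$, and let $Z^{(H,l)}$ be four mutually independent Inverse Gaussian subordinators, i.e. increasing Lévy processes with $E_{\mathcal{Q}}[\exp(i\vartheta Z^{(H,l)}_s)]=\exp(s\Psi_{H,l}(\vartheta))$, where $\Psi_{H,l}(\vartheta)=-a_{H,l}\big(\sqrt{-2i\vartheta+b_{H,l}^2}-b_{H,l}\big)$ for $\vartheta\in\mathbb{R}$ (principal square root). The Ornstein–Uhlenbeck processes are the solutions of $dF^{(l)}_t=-\lambda_{F,l}F^{(l)}_t\,dt+dZ^{(F,l)}_{\lambda_{F,l}t}$ and $dV^{(l)}_t=-\lambda_{V,l}V^{(l)}_t\,dt+dZ^{(V,l)}_{\lambda_{V,l}t}$ with deterministic initial values $F^{(l)}_0$, $V^{(l)}_0$. Integrated processes are $F^+_t=\big(\int_0^tF^{(1)}_s\,ds,\int_0^tF^{(2)}_s\,ds\big)$ and $V^+_t=\big(\int_0^tV^{(1)}_s\,ds,\int_0^tV^{(2)}_s\,ds\big)$. $A=(a_{kl})_{k,l=1,2}$ (entries with plain integer subscripts, not to be confused with the parameters $a_{F,l},a_{V,l}$) is a deterministic real orthogonal $2\times2$ matrix, $A'$ its transpose. The covariance process is $\Sigma_t=\mathrm{diag}(F_t)+A\,\mathrm{diag}(V_t)A'$, and $\Sigma_t^+=\int_0^t\Sigma_s\,ds=\mathrm{diag}(F^+_t)+A\,\mathrm{diag}(V^+_t)A'$,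 where $\mathrm{diag}(v)$ is the diagonal matrix with diagonal $v$. *)

theory Defs
  imports "HOL-Probability.Probability"
begin

section \<open>Inverse Gaussian subordinators\<close>

text \<open>Processes have type \<open>real \<Rightarrow> 'w \<Rightarrow> real\<close>; only times \<open>t \<ge> 0\<close> are meaningful, and path
  properties are required almost surely.\<close>

definition cadlag :: "(real \<Rightarrow> real) \<Rightarrow> bool" where
  "cadlag f \<longleftrightarrow> (\<forall>t\<ge>0. (f \<longlongrightarrow> f t) (at_right t)) \<and> (\<forall>t>0. \<exists>l. (f \<longlongrightarrow> l) (at_left t))"

text \<open>Stochastic continuity is not listed, since it follows from cadlag paths and stationary
  increments.\<close>

definition levy_process :: "'w measure \<Rightarrow> (real \<Rightarrow> 'w \<Rightarrow> real) \<Rightarrow> bool" where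
  "levy_process M Z \<longleftrightarrow>
     (\<forall>t\<ge>0. Z t \<in> borel_measurable M) \<and>
     (AE \<omega> in M. Z 0 \<omega> = 0) \<and>
     (\<forall>n (\<tau> :: nat \<Rightarrow> real). 0 \<le> \<tau> 0 \<longrightarrow> (\<forall>k<n. \<tau> k \<le> \<tau> (Suc k)) \<longrightarrow>
        prob_space.indep_vars M (\<lambda>_. borel) (\<lambda>k \<omega>. Z (\<tau> (Suc k)) \<omega> - Z (\<tau> k) \<omega>) {..<n}) \<and>
     (\<forall>s\<ge>0. \<forall>t\<ge>0. distr M borel (\<lambda>\<omega>. Z (s + t) \<omega> - Z s \<omega>) = distr M borel (Z t)) \<and>
     (AE \<omega> in M. cadlag (\<lambda>t. Z t \<omega>))"

definition subordinator :: "'w measure \<Rightarrow> (real \<Rightarrow> 'w \<Rightarrow> real) \<Rightarrow> bool" where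
  "subordinator M Z \<longleftrightarrow> levy_process M Z \<and> (AE \<omega> in M. mono_on {0..} (\<lambda>t. Z t \<omega>))"

definition IG_exponent :: "real \<Rightarrow> real \<Rightarrow> real \<Rightarrow> complex" where
  "IG_exponent a b \<theta> = - a * (csqrt (- 2 * \<i> * \<theta> + b\<^sup>2) - b)"

definition IG_subordinator :: "'w measure \<Rightarrow> real \<Rightarrow> real \<Rightarrow> (real \<Rightarrow> 'w \<Rightarrow> real) \<Rightarrow> bool" where
  "IG_subordinator M a b Z \<longleftrightarrow> subordinator M Z \<and>
     (\<forall>s\<ge>0. \<forall>\<theta>::real.
        prob_space.expectation M (\<lambda>\<omega>. exp (\<i> * \<theta> * Z s \<omega>)) = exp (s * IG_exponent a b \<theta>))"

section \<open>Ornstein--Uhlenbeck processes and the covariance process\<close>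

text \<open>The equation \<open>dX\<^sub>t = -lam X\<^sub>t dt + dZ\<^bsub>lam t\<^esub>\<close>, \<open>X\<^sub>0 = x0\<close>, has additive noise and is
  therefore read pathwise in integrated form (using \<open>Z\<^sub>0 = 0\<close>). Joint measurability makes the
  time integrals of \<open>X\<close> random variables even if \<open>M\<close> is not complete.\<close>

definition OU_solution ::
    "'w measure \<Rightarrow> real \<Rightarrow> (real \<Rightarrow> 'w \<Rightarrow> real) \<Rightarrow> real \<Rightarrow> (real \<Rightarrow> 'w \<Rightarrow> real) \<Rightarrow> bool" where
  "OU_solution M lam Z x0 X \<longleftrightarrow>
     case_prod X \<in> borel_measurable (restrict_space borel {0..} \<Otimes>\<^sub>M M) \<and>
     (AE \<omega> in M. \<forall>t\<ge>0. set_integrable lborel {0..t} (\<lambda>s. X s \<omega>) \<and>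
        X t \<omega> = x0 - lam * (LINT s:{0..t}|lborel. X s \<omega>) + Z (lam * t) \<omega>)"

datatype component = CF | CV  \<comment> \<open>the index set \<open>{F, V}\<close>\<close>

definition diag :: "real ^ 2 \<Rightarrow> real ^ 2 ^ 2" where
  "diag v = (\<chi> k j. if k = j then v $ k else 0)"

definition covariance :: "real ^ 2 ^ 2 \<Rightarrow> real ^ 2 \<Rightarrow> real ^ 2 \<Rightarrow> real ^ 2 ^ 2" where
  "covariance A f v = diag f + A ** diag v ** transpose A"

definition integrated :: "(real \<Rightarrow> 'w \<Rightarrow> real ^ 2) \<Rightarrow> real \<Rightarrow> 'w \<Rightarrow> real ^ 2" where
  "integrated X t \<omega> = (\<chi> l. LINT s:{0..t}|lborel. X s \<omega> $ l)"

definition integrated_covariance ::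
    "real ^ 2 ^ 2 \<Rightarrow> (real \<Rightarrow> 'w \<Rightarrow> real ^ 2) \<Rightarrow> (real \<Rightarrow> 'w \<Rightarrow> real ^ 2) \<Rightarrow> real \<Rightarrow> 'w \<Rightarrow> real ^ 2 ^ 2"
  where "integrated_covariance A F V t \<omega> = covariance A (integrated F t \<omega>) (integrated V t \<omega>)"

text \<open>The integrated covariance is the time integral of the covariance process.\<close>

lemma covariance_nth:
  "covariance A f v $ k $ j = (if k = j then f $ k else 0) + (\<Sum>l\<in>UNIV. A $ k $ l * A $ j $ l * v $ l)"
  by (simp add: covariance_def diag_def matrix_matrix_mult_def transpose_def
      if_distrib[where f = "\<lambda>x. _ * x"] cong: if_cong) (simp add: mult_ac)

lemma integrated_covariance_eq:
  assumes "\<And>l. set_integrable lborel {0..t} (\<lambda>s. F s \<omega> $ l)"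
    and "\<And>l. set_integrable lborel {0..t} (\<lambda>s. V s \<omega> $ l)"
  shows "integrated_covariance A F V t \<omega> $ k $ j =
    (LINT s:{0..t}|lborel. covariance A (F s \<omega>) (V s \<omega>) $ k $ j)"
proof -
  have i: "set_integrable lborel {0..t} (\<lambda>s. c * V s \<omega> $ l)" for c l
    by (simp add: assms(2))
  have i1: "set_integrable lborel {0..t} (\<lambda>s. if k = j then F s \<omega> $ k else 0)"
    using assms(1)[of k] by (cases "k = j") (simp_all add: set_integrable_def)
  show ?thesis
    unfolding integrated_covariance_def covariance_nth sum_2 integrated_def
    by (simp add: i i1 set_integral_add assms)
qed

end

theory Submission
  imports Defs
begin

text \<open>The integral of each Ornstein--Uhlenbeck process over \<open>[0, t]\<close> is a deterministic term plus a
  Wiener-type integral of \<open>(1 - exp (- lam (t - s))) / lam\<close> against \<open>dZ\<^bsub>lam s\<^esub>\<close>. Since \<open>Z\<close>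
  is increasing, its Riemann--Stieltjes sums on \<open>n\<close> cells approximate it pathwise up to
  \<open>(t / n) Z\<^bsub>lam t\<^esub>\<close>, hence also in mean square. The sums are linear combinations of independent
  increments, whose first two moments follow from the first two derivatives of the characteristic
  function at \<open>0\<close>: mean \<open>s a / b\<close> and variance \<open>s a / b\<^sup>3\<close> over time \<open>s\<close>. In the limit the
  integral has mean \<open>\<phi> - \<i> D\<close> (respectively \<open>\<nu> - \<i> D\<close>) and variance \<open>- D2\<close>, and the entries
  of the integrated covariance are linear combinations of four independent such integrals.\<close>

subsection \<open>Moments of the Inverse Gaussian subordinator\<close>

text \<open>By the half-angle formula the left side is the square of \<open>2 * sin (x / 2)\<close>.
  The bound supplies the majorant for the second-order difference quotients of a cosine.\<close>

lemma two_minus_two_cos_le: "2 * (1 - cos x) \<le> x\<^sup>2" for x :: real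
proof -
  have "2 * (1 - cos x) = (2 * sin (x / 2))\<^sup>2"
    using cos_double_sin[of "x / 2"] by (simp add: power2_eq_square)
  also have "\<dots> \<le> x\<^sup>2"
    using abs_sin_x_le_abs_x[of "x / 2"] unfolding abs_le_square_iff[symmetric]
    by (simp add: abs_mult)
  finally show ?thesis .
qed

text \<open>No moment of \<open>X\<close> is assumed. The quotients
  \<open>2 * (1 - cos (\<theta> * X)) / \<theta>^2\<close> are nonnegative and tend pointwise to
  \<open>X^2\<close>, so Fatou's lemma gives integrability of \<open>X^2\<close>. Once this is
  known, \<open>X^2\<close> dominates the same quotients and dominated convergence identifies the
  second moment; the sine quotients are dominated by the modulus of \<open>X\<close> and give the
  mean.\<close>

lemma (in prob_space) moments_from_trig_limits:
  fixes X :: "'a \<Rightarrow> real"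
  assumes [measurable]: "random_variable borel X"
    and cos_lim: "((\<lambda>\<theta>. 2 * (1 - expectation (\<lambda>\<omega>. cos (\<theta> * X \<omega>))) / \<theta>\<^sup>2) \<longlongrightarrow> q) (at 0)"
    and sin_lim: "((\<lambda>\<theta>. expectation (\<lambda>\<omega>. sin (\<theta> * X \<omega>)) / \<theta>) \<longlongrightarrow> m) (at 0)"
  shows "integrable M (\<lambda>\<omega>. (X \<omega>)\<^sup>2)" and "expectation (\<lambda>\<omega>. (X \<omega>)\<^sup>2) = q" and "expectation X = m"
proof -
  \<comment> \<open>Fatou's lemma and dominated convergence are applied to sequences, so the limits
    at 0 are sampled along a null sequence that avoids 0.\<close>
  define \<theta> :: "nat \<Rightarrow> real" where "\<theta> n = inverse (real (Suc n))" for n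
  have \<theta>: "filterlim \<theta> (at 0) sequentially"
    unfolding \<theta>_def filterlim_at using LIMSEQ_inverse_real_of_nat by auto
  have \<theta>_nz: "\<theta> n \<noteq> 0" for n by (simp add: \<theta>_def)
  define h where "h n \<omega> = 2 * (1 - cos (\<theta> n * X \<omega>)) / (\<theta> n)\<^sup>2" for n \<omega>
  define u where "u n \<omega> = sin (\<theta> n * X \<omega>) / \<theta> n" for n \<omega>
  have [measurable]: "h n \<in> borel_measurable M" "u n \<in> borel_measurable M" for n
    unfolding h_def u_def by measurable
  have cos_int: "integrable M (\<lambda>\<omega>. cos (\<theta> n * X \<omega>))" for n
    by (rule integrable_const_bound[where B = 1]) auto
  have h_int: "integrable M (h n)" for n
    unfolding h_def using cos_int by auto
  have h_nonneg: "0 \<le> h n \<omega>" for n \<omega>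
    by (simp add: h_def)
  have h_le: "h n \<omega> \<le> (X \<omega>)\<^sup>2" for n \<omega>
    using two_minus_two_cos_le[of "\<theta> n * X \<omega>"] \<theta>_nz
    by (simp add: h_def divide_simps power_mult_distrib mult_ac)
  have h_lim: "(\<lambda>n. h n \<omega>) \<longlonglongrightarrow> (X \<omega>)\<^sup>2" for \<omega>
  proof -
    have "((\<lambda>y. 2 * (1 - cos (y * x)) / y\<^sup>2) \<longlongrightarrow> x\<^sup>2) (at 0)" for x :: real
    proof (rule lhopital[where f' = "\<lambda>y. 2 * x * sin (y * x)" and g' = "\<lambda>y. 2 * y"])
      have "((\<lambda>y. sin (y * x)) has_real_derivative x) (at 0)"
        by (auto intro!: derivative_eq_intros)
      then have "((\<lambda>y. sin (y * x) / y) \<longlongrightarrow> x) (at 0)"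
        by (simp add: has_field_derivative_iff)
      then have "((\<lambda>y. x * (sin (y * x) / y)) \<longlongrightarrow> x * x) (at 0)"
        by (intro tendsto_intros)
      then show "((\<lambda>y. 2 * x * sin (y * x) / (2 * y)) \<longlongrightarrow> x\<^sup>2) (at 0)"
        by (simp add: power2_eq_square)
    qed (auto intro!: derivative_eq_intros tendsto_eq_intros always_eventually simp: eventually_at_filter)
    from filterlim_compose[OF this \<theta>] show ?thesis
      by (simp add: h_def)
  qed
  have Eh: "(\<lambda>n. expectation (h n)) \<longlonglongrightarrow> q"
  proof -
    have "expectation (h n) = 2 * (1 - expectation (\<lambda>\<omega>. cos (\<theta> n * X \<omega>))) / (\<theta> n)\<^sup>2" for n
      unfolding h_def using cos_int by (simp add: prob_space)
    then show ?thesis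
      using filterlim_compose[OF cos_lim \<theta>] by simp
  qed
  \<comment> \<open>Fatou's lemma works with the nonnegative integral, which is defined before
    \<open>X^2\<close> is known to be integrable.\<close>
  have "(\<integral>\<^sup>+\<omega>. ennreal ((X \<omega>)\<^sup>2) \<partial>M) = (\<integral>\<^sup>+\<omega>. liminf (\<lambda>n. ennreal (h n \<omega>)) \<partial>M)"
    by (intro nn_integral_cong lim_imp_Liminf[symmetric] tendsto_ennrealI h_lim) simp
  also have "\<dots> \<le> liminf (\<lambda>n. \<integral>\<^sup>+\<omega>. ennreal (h n \<omega>) \<partial>M)"
    by (rule nn_integral_liminf) simp
  also have "\<dots> = liminf (\<lambda>n. ennreal (expectation (h n)))"
    by (simp add: nn_integral_eq_integral h_int h_nonneg)
  also have "\<dots> = ennreal q"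
    by (intro lim_imp_Liminf tendsto_ennrealI Eh) simp
  finally show X2: "integrable M (\<lambda>\<omega>. (X \<omega>)\<^sup>2)"
    by (intro integrableI_bounded) (auto simp: less_top[symmetric] top_unique)
  have "(\<lambda>n. expectation (h n)) \<longlonglongrightarrow> expectation (\<lambda>\<omega>. (X \<omega>)\<^sup>2)"
    by (rule integral_dominated_convergence[where w = "\<lambda>\<omega>. (X \<omega>)\<^sup>2"])
       (use X2 h_lim h_le h_nonneg in auto)
  with Eh show "expectation (\<lambda>\<omega>. (X \<omega>)\<^sup>2) = q"
    using LIMSEQ_unique by blast
  have X1: "integrable M X"
    by (rule square_integrable_imp_integrable[OF _ X2]) simp
  have u_lim: "(\<lambda>n. u n \<omega>) \<longlonglongrightarrow> X \<omega>" for \<omega>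
  proof -
    have "((\<lambda>y. sin (y * X \<omega>)) has_real_derivative X \<omega>) (at 0)"
      by (auto intro!: derivative_eq_intros)
    then have "((\<lambda>y. sin (y * X \<omega>) / y) \<longlongrightarrow> X \<omega>) (at 0)"
      by (simp add: has_field_derivative_iff)
    from filterlim_compose[OF this \<theta>] show ?thesis
      by (simp add: u_def)
  qed
  have "(\<lambda>n. expectation (u n)) \<longlonglongrightarrow> expectation X"
  proof (rule integral_dominated_convergence[where w = "\<lambda>\<omega>. \<bar>X \<omega>\<bar>"])
    have "\<bar>u n \<omega>\<bar> \<le> \<bar>X \<omega>\<bar>" for n \<omega>
      using abs_sin_x_le_abs_x[of "\<theta> n * X \<omega>"] \<theta>_nz
      by (simp add: u_def divide_simps abs_mult mult_ac)
    then show "AE \<omega> in M. norm (u n \<omega>) \<le> \<bar>X \<omega>\<bar>" for n by simp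
  qed (use X1 u_lim in auto)
  moreover have "(\<lambda>n. expectation (u n)) \<longlonglongrightarrow> m"
    using filterlim_compose[OF sin_lim \<theta>] unfolding u_def by simp
  ultimately show "expectation X = m"
    using LIMSEQ_unique by blast
qed

text \<open>\<open>G\<close> is the characteristic function at time \<open>s\<close>, extended to
  complex arguments. On the real axis the radicand of \<open>w\<close> has real part
  \<open>b^2 > 0\<close>, hence avoids the branch cut of \<open>csqrt\<close>, and the chain rule
  applies with \<open>w' = - \<i> / w\<close>. The second derivative at 0 is minus the second
  moment.\<close>

lemma IG_characteristic_derivs:
  fixes s a b :: real and w G G' :: "complex \<Rightarrow> complex"
  assumes "b > 0"
  defines "w \<equiv> (\<lambda>z :: complex. csqrt (- 2 * \<i> * z + b\<^sup>2))"
  defines "G \<equiv> (\<lambda>z :: complex. exp (s * (- a * (w z - b))))"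
  defines "G' \<equiv> (\<lambda>z :: complex. \<i> * s * a / w z * G z)"
  shows "(G has_field_derivative G' (of_real \<theta>)) (at (of_real \<theta>))"
    and "(G' has_field_derivative of_real (- (s * a / b)\<^sup>2 - s * a / b ^ 3)) (at 0)"
proof -
  have np: "- 2 * \<i> * of_real \<theta> + b\<^sup>2 \<notin> \<real>\<^sub>\<le>\<^sub>0" for \<theta> :: real
    using assms by (auto simp: complex_nonpos_Reals_iff)
  have w: "(w has_field_derivative - \<i> / w (of_real \<theta>)) (at (of_real \<theta>))" for \<theta> :: real
  proof -
    have "((\<lambda>z. - 2 * \<i> * z + b\<^sup>2) has_field_derivative - 2 * \<i>) (at (of_real \<theta>))"
      by (auto intro!: derivative_eq_intros)
    from DERIV_chain2[OF has_field_derivative_csqrt[OF np[of \<theta>]] this]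
    show ?thesis unfolding w_def by (simp add: field_simps)
  qed
  show G: "(G has_field_derivative G' (of_real \<theta>)) (at (of_real \<theta>))" for \<theta> :: real
  proof -
    have "((\<lambda>z. s * (- a * (w z - b))) has_field_derivative s * (- a * (- \<i> / w (of_real \<theta>))))
        (at (of_real \<theta>))"
      by (intro DERIV_cmult) (use DERIV_diff[OF w DERIV_const] in simp)
    from DERIV_chain2[OF DERIV_exp this] show ?thesis
      unfolding G_def G'_def by (simp add: mult_ac)
  qed
  have w0: "w 0 = b"
    using assms by (simp add: w_def flip: of_real_power)
  have dw: "(w has_field_derivative - \<i> / b) (at 0)" using w[of 0] w0 by simp
  have G0: "G 0 = 1" by (simp add: G_def w0)
  have dG: "(G has_field_derivative \<i> * s * a / b) (at 0)"
    using G[of 0] by (simp add: G'_def G0 w0)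
  have "((\<lambda>z. \<i> * s * a / w z) has_field_derivative
      (0 * w 0 - \<i> * s * a * (- \<i> / b)) / (w 0 * w 0)) (at 0)"
    using assms(1) by (intro DERIV_divide DERIV_const dw) (simp add: w0)
  from DERIV_mult[OF this dG]
  have "(G' has_field_derivative - (s * a) / b ^ 3 + \<i> * s * a / b * (\<i> * s * a / b)) (at 0)"
    unfolding G'_def using assms(1) by (simp add: w0 G0 power3_eq_cube mult_ac)
  moreover have "- (s * a) / b ^ 3 + \<i> * s * a / b * (\<i> * s * a / b) =
      of_real (- (s * a / b)\<^sup>2 - s * a / b ^ 3)"
    using assms(1) by (simp add: field_simps power2_eq_square power3_eq_cube)
  ultimately show "(G' has_field_derivative of_real (- (s * a / b)\<^sup>2 - s * a / b ^ 3)) (at 0)"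
    by simp
qed

lemma has_real_derivative_Re_Im:
  fixes G :: "complex \<Rightarrow> complex"
  assumes "(G has_field_derivative G') (at (of_real x))"
  shows "((\<lambda>y. Re (G (of_real y))) has_real_derivative Re G') (at x)"
    and "((\<lambda>y. Im (G (of_real y))) has_real_derivative Im G') (at x)"
proof -
  have "((\<lambda>y. G (of_real y)) has_vector_derivative G') (at x)"
    using has_vector_derivative_real_field[OF assms] .
  then show "((\<lambda>y. Re (G (of_real y))) has_real_derivative Re G') (at x)"
    and "((\<lambda>y. Im (G (of_real y))) has_real_derivative Im G') (at x)"
    by (simp_all add: has_vector_derivative_complex_iff has_real_derivative_iff_has_vector_derivative)
qed

text \<open>Real and imaginary part of the characteristic function are the expectations of
  \<open>cos (\<theta> * Z s)\<close> and \<open>sin (\<theta> * Z s)\<close>, so the derivatives of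
  \<open>G\<close> at 0 provide the two limits that \<open>moments_from_trig_limits\<close> asks
  for.\<close>

lemma (in prob_space) IG_subordinator_moments:
  assumes Z: "IG_subordinator M a b Z" and "b > 0" "s \<ge> 0"
  shows "integrable M (\<lambda>\<omega>. (Z s \<omega>)\<^sup>2)"
    and "expectation (\<lambda>\<omega>. (Z s \<omega>)\<^sup>2) = (s * a / b)\<^sup>2 + s * a / b ^ 3"
    and "expectation (Z s) = s * a / b"
proof -
  have [measurable]: "random_variable borel (Z s)"
    using Z \<open>s \<ge> 0\<close> by (auto simp: IG_subordinator_def subordinator_def levy_process_def)
  define w where "w = (\<lambda>z :: complex. csqrt (- 2 * \<i> * z + b\<^sup>2))"
  define G where "G = (\<lambda>z :: complex. exp (s * (- a * (w z - b))))"
  define G' where "G' = (\<lambda>z :: complex. \<i> * s * a / w z * G z)"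
  have dG: "(G has_field_derivative G' (of_real \<theta>)) (at (of_real \<theta>))"
      for \<theta> :: real
    using IG_characteristic_derivs(1)[OF \<open>b > 0\<close>, of s a] unfolding w_def G_def G'_def by simp
  have dG': "(G' has_field_derivative of_real (- (s * a / b)\<^sup>2 - s * a / b ^ 3)) (at (of_real 0))"
    using IG_characteristic_derivs(2)[OF \<open>b > 0\<close>, of s a] unfolding w_def G_def G'_def by simp
  have w0: "w 0 = b"
    using \<open>b > 0\<close> by (simp add: w_def flip: of_real_power)
  have G0: "G 0 = 1" and G'0: "G' 0 = \<i> * (s * a / b)"
    by (simp_all add: G_def G'_def w0)
  have char: "expectation (\<lambda>\<omega>. exp (\<i> * \<theta> * Z s \<omega>)) = G (of_real \<theta>)" for \<theta> :: real
    using Z \<open>s \<ge> 0\<close> by (simp add: IG_subordinator_def IG_exponent_def G_def w_def)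
  have int: "integrable M (\<lambda>\<omega>. exp (\<i> * \<theta> * Z s \<omega>))" for \<theta> :: real
    by (rule integrable_const_bound[where B = 1]) (auto simp: norm_exp_eq_Re)
  have cos_eq: "expectation (\<lambda>\<omega>. cos (\<theta> * Z s \<omega>)) = Re (G (of_real \<theta>))" for \<theta> :: real
    using integral_Re[OF int[of \<theta>]] by (simp add: Re_exp flip: char)
  have sin_eq: "expectation (\<lambda>\<omega>. sin (\<theta> * Z s \<omega>)) = Im (G (of_real \<theta>))" for \<theta> :: real
    using integral_Im[OF int[of \<theta>]] by (simp add: Im_exp flip: char)
  \<comment> \<open>One use of l'Hopital's rule leaves the quotient
    \<open>- Re (G' \<theta>) / \<theta>\<close>. Since \<open>G' 0\<close> is purely imaginary,
    this is minus a difference quotient of \<open>Re G'\<close> at 0, so its limit is minus the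
    second derivative.\<close>
  have "((\<lambda>\<theta>. 2 * (1 - Re (G (of_real \<theta>))) / \<theta>\<^sup>2) \<longlongrightarrow> (s * a / b)\<^sup>2 + s * a / b ^ 3) (at 0)"
  proof (rule lhopital[where f' = "\<lambda>\<theta>. - 2 * Re (G' (of_real \<theta>))" and g' = "\<lambda>\<theta>. 2 * \<theta>"])
    have "((\<lambda>\<theta>. Re (G' (of_real \<theta>)) / \<theta>) \<longlongrightarrow> - (s * a / b)\<^sup>2 - s * a / b ^ 3) (at 0)"
      using has_real_derivative_Re_Im(1)[OF dG'] by (simp add: has_field_derivative_iff G'0)
    from tendsto_minus[OF this]
    show "((\<lambda>\<theta>. - 2 * Re (G' (of_real \<theta>)) / (2 * \<theta>)) \<longlongrightarrow> (s * a / b)\<^sup>2 + s * a / b ^ 3) (at 0)"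
      by (simp add: add.commute)
    have d: "((\<lambda>\<theta>. 2 * (1 - Re (G (of_real \<theta>)))) has_real_derivative - 2 * Re (G' (of_real x))) (at x)"
      for x :: real
      using DERIV_cmult[OF DERIV_diff[OF DERIV_const has_real_derivative_Re_Im(1)[OF dG[of x]]], of 2 1] by simp
    then show "\<forall>\<^sub>F x in at 0. ((\<lambda>\<theta>. 2 * (1 - Re (G (of_real \<theta>)))) has_real_derivative
        - 2 * Re (G' (of_real x))) (at x)"
      by simp
    show "((\<lambda>\<theta>. 2 * (1 - Re (G (of_real \<theta>)))) \<longlongrightarrow> 0) (at 0)"
      using DERIV_isCont[OF d[of 0]] by (simp add: isCont_def G0)
  qed (auto intro!: derivative_eq_intros tendsto_eq_intros always_eventually simp: eventually_at_filter)
  then have c: "((\<lambda>\<theta>. 2 * (1 - expectation (\<lambda>\<omega>. cos (\<theta> * Z s \<omega>))) / \<theta>\<^sup>2) \<longlongrightarrow>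
      (s * a / b)\<^sup>2 + s * a / b ^ 3) (at 0)"
    by (simp add: cos_eq)
  have si: "((\<lambda>\<theta>. expectation (\<lambda>\<omega>. sin (\<theta> * Z s \<omega>)) / \<theta>) \<longlongrightarrow> s * a / b) (at 0)"
    using has_real_derivative_Re_Im(2)[OF dG[of 0]]
    by (simp add: sin_eq has_field_derivative_iff G0 G'0)
  note m = moments_from_trig_limits[OF \<open>random_variable borel (Z s)\<close> c si]
  show "integrable M (\<lambda>\<omega>. (Z s \<omega>)\<^sup>2)"
    and "expectation (\<lambda>\<omega>. (Z s \<omega>)\<^sup>2) = (s * a / b)\<^sup>2 + s * a / b ^ 3"
    and "expectation (Z s) = s * a / b"
    by (rule m)+
qed

subsection \<open>Pathwise approximation of the integrated process\<close>

text \<open>A one-sided Gronwall inequality: \<open>P = d + lam \<integral> d\<close> is nondecreasing by \<open>step\<close>, and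
  \<open>\<integral> d\<close> solves a linear equation with the continuous source \<open>P\<close>, so that no derivative of \<open>d\<close>
  is needed.\<close>

lemma exp_times_nondecreasing:
  fixes d :: "real \<Rightarrow> real"
  assumes cont: "continuous_on {u..v} d" and "u \<le> v" "lam > 0"
    and step: "\<And>r s. u \<le> r \<Longrightarrow> r \<le> s \<Longrightarrow> s \<le> v \<Longrightarrow> - lam * integral {r..s} d \<le> d s - d r"
  shows "exp (lam * u) * d u \<le> exp (lam * v) * d v"
proof -
  define K where "K s = integral {u..s} d" for s
  define P where "P s = d s + lam * K s" for s
  have dK: "(K has_real_derivative d s) (at s within {u..v})" if "s \<in> {u..v}" for s
    unfolding K_def using integral_has_real_derivative[OF cont that] .
  have P_le: "P r \<le> P s" if "u \<le> r" "r \<le> s" "s \<le> v" for r s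
  proof -
    have "d integrable_on {u..s}"
      using cont that by (intro integrable_continuous_interval) (auto intro: continuous_on_subset)
    from Henstock_Kurzweil_Integration.integral_combine[OF that(1,2) this]
    have "K s = K r + integral {r..s} d"
      by (simp add: K_def)
    with step[OF that] show ?thesis
      by (simp add: P_def algebra_simps)
  qed
  \<comment> \<open>As \<open>K' = d\<close>, the definition of \<open>P\<close> reads
    \<open>K' + lam * K = P\<close>, and \<open>exp (lam * s)\<close> is the integrating factor.
    Replacing \<open>P\<close> by its largest value \<open>P v\<close> under the integral then
    bounds \<open>K v\<close> from above.\<close>
  have "((\<lambda>s. exp (lam * s) * P s) has_integral exp (lam * v) * K v - exp (lam * u) * K u) {u..v}"
  proof (rule fundamental_theorem_of_calculus[OF \<open>u \<le> v\<close>])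
    fix s assume s: "s \<in> {u..v}"
    have "((\<lambda>s. exp (lam * s) * K s) has_real_derivative exp (lam * s) * P s) (at s within {u..v})"
      by (auto intro!: derivative_eq_intros dK s simp: P_def algebra_simps)
    then show "((\<lambda>s. exp (lam * s) * K s) has_vector_derivative exp (lam * s) * P s) (at s within {u..v})"
      by (simp add: has_real_derivative_iff_has_vector_derivative)
  qed
  moreover have "((\<lambda>s. exp (lam * s) * P v) has_integral
      exp (lam * v) * P v / lam - exp (lam * u) * P v / lam) {u..v}"
    using \<open>lam > 0\<close>
    by (intro fundamental_theorem_of_calculus[OF \<open>u \<le> v\<close>])
       (auto intro!: derivative_eq_intros simp flip: has_real_derivative_iff_has_vector_derivative)
  ultimately have "exp (lam * v) * K v - exp (lam * u) * K u
      \<le> exp (lam * v) * P v / lam - exp (lam * u) * P v / lam"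
    by (rule has_integral_le) (use P_le in auto)
  then have "exp (lam * v) * (lam * K v) \<le> exp (lam * v) * P v - exp (lam * u) * P v"
    using \<open>lam > 0\<close> by (simp add: K_def field_simps)
  then have "exp (lam * u) * P v \<le> exp (lam * v) * d v"
    by (simp add: P_def algebra_simps)
  moreover have "exp (lam * u) * d u \<le> exp (lam * u) * P v"
    using P_le[of u v] \<open>u \<le> v\<close> by (simp add: P_def K_def)
  ultimately show ?thesis by linarith
qed

text \<open>The integral \<open>I\<close> of \<open>X\<close> satisfies
  \<open>I' = x + z - lam * I\<close> in integrated form. On the cell from \<open>u\<close> to
  \<open>v\<close> the source lies between \<open>c = x + z u\<close> and
  \<open>c = x + z v\<close>. With a constant source \<open>c\<close> the quantity
  \<open>exp (lam * s) * (I s - c / lam)\<close> would be constant; here it does not decrease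
  between the end points for the first value and does not increase for the second.\<close>

lemma OU_integral_bounds:
  fixes X z :: "real \<Rightarrow> real"
  assumes "lam > 0" "0 \<le> u" "u \<le> v"
    and X: "X integrable_on {0..v}"
    and eq: "\<And>s. 0 \<le> s \<Longrightarrow> s \<le> v \<Longrightarrow> X s = x - lam * integral {0..s} X + z s"
    and mono: "mono_on {0..v} z"
  defines "J \<equiv> (\<lambda>s. exp (lam * s) * integral {0..s} X)"
    and "\<Delta> \<equiv> (exp (lam * v) - exp (lam * u)) / lam"
  shows "(x + z u) * \<Delta> \<le> J v - J u" and "J v - J u \<le> (x + z v) * \<Delta>"
proof -
  define I where "I s = integral {0..s} X" for s
  have cont: "continuous_on {u..v} I"
    unfolding I_def
    by (rule continuous_on_subset[OF indefinite_integral_continuous_1[OF X]]) (use assms in auto)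
  have I_diff: "I s - I r = integral {r..s} X" and Xi: "X integrable_on {r..s}"
    if "u \<le> r" "r \<le> s" "s \<le> v" for r s
  proof -
    have "X integrable_on {0..s}"
      by (rule integrable_subinterval_real[OF X]) (use that in auto)
    from Henstock_Kurzweil_Integration.integral_combine[OF _ that(2) this] that \<open>0 \<le> u\<close>
    show "I s - I r = integral {r..s} X" by (simp add: I_def)
    show "X integrable_on {r..s}"
      by (rule integrable_subinterval_real[OF X]) (use that \<open>0 \<le> u\<close> in auto)
  qed
  have Ii: "I integrable_on {r..s}" if "u \<le> r" "s \<le> v" for r s
    by (rule integrable_continuous_interval, rule continuous_on_subset[OF cont]) (use that in auto)
  have diff: "lam * integral {r..s} (\<lambda>y. I y - c / lam) = lam * integral {r..s} I - (s - r) * c"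
    if "u \<le> r" "r \<le> s" "s \<le> v" for r s c
    using that Ii[OF that(1,3)] \<open>lam > 0\<close> by (subst integral_diff) (auto simp: field_simps)
  have lo: "(s - r) * c - lam * integral {r..s} I \<le> I s - I r"
    if rs: "u \<le> r" "r \<le> s" "s \<le> v" and c: "c = x + z u" for r s c
  proof -
    have "integral {r..s} (\<lambda>y. c - lam * I y) \<le> integral {r..s} X"
    proof (rule integral_le)
      fix y assume "y \<in> {r..s}"
      then show "c - lam * I y \<le> X y"
        using eq[of y] mono_onD[OF mono, of u y] rs \<open>0 \<le> u\<close> by (auto simp: c I_def)
    qed (use Ii Xi rs in \<open>auto intro!: integrable_diff integrable_on_mult_right\<close>)
    moreover have "integral {r..s} (\<lambda>y. c - lam * I y) = (s - r) * c - lam * integral {r..s} I"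
      using rs Ii[OF rs(1,3)] by (subst integral_diff) (auto intro!: integrable_on_mult_right)
    ultimately show ?thesis using I_diff[OF rs] by simp
  qed
  have hi: "I s - I r \<le> (s - r) * c - lam * integral {r..s} I"
    if rs: "u \<le> r" "r \<le> s" "s \<le> v" and c: "c = x + z v" for r s c
  proof -
    have "integral {r..s} X \<le> integral {r..s} (\<lambda>y. c - lam * I y)"
    proof (rule integral_le)
      fix y assume "y \<in> {r..s}"
      then show "X y \<le> c - lam * I y"
        using eq[of y] mono_onD[OF mono, of y v] rs \<open>0 \<le> u\<close> by (auto simp: c I_def)
    qed (use Ii Xi rs in \<open>auto intro!: integrable_diff integrable_on_mult_right\<close>)
    moreover have "integral {r..s} (\<lambda>y. c - lam * I y) = (s - r) * c - lam * integral {r..s} I"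
      using rs Ii[OF rs(1,3)] by (subst integral_diff) (auto intro!: integrable_on_mult_right)
    ultimately show ?thesis using I_diff[OF rs] by simp
  qed
  have hi': "lam * integral {r..s} I - (s - r) * (x + z v) \<le> I r - I s"
    if "u \<le> r" "r \<le> s" "s \<le> v" for r s
    using hi[OF that refl] by simp
  \<comment> \<open>The sign of this difference is what \<open>exp_times_nondecreasing\<close>
    yields, applied to \<open>I - c / lam\<close> for the lower bound and to its negative for the
    upper one.\<close>
  have J: "J v - J u - c * \<Delta> = exp (lam * v) * (I v - c / lam) - exp (lam * u) * (I u - c / lam)" for c
    by (simp add: J_def \<Delta>_def I_def algebra_simps diff_divide_distrib)
  have "exp (lam * u) * (I u - (x + z u) / lam) \<le> exp (lam * v) * (I v - (x + z u) / lam)"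
    by (rule exp_times_nondecreasing[of _ _ "\<lambda>s. I s - (x + z u) / lam", OF _ \<open>u \<le> v\<close> \<open>lam > 0\<close>])
       (use lo \<open>lam > 0\<close> in \<open>auto intro!: continuous_intros cont simp: diff\<close>)
  then show "(x + z u) * \<Delta> \<le> J v - J u"
    using J[of "x + z u"] by simp
  have "exp (lam * u) * - (I u - (x + z v) / lam) \<le> exp (lam * v) * - (I v - (x + z v) / lam)"
    by (rule exp_times_nondecreasing[of _ _ "\<lambda>s. - (I s - (x + z v) / lam)", OF _ \<open>u \<le> v\<close> \<open>lam > 0\<close>])
       (use hi' \<open>lam > 0\<close> in \<open>auto intro!: continuous_intros cont simp del: minus_diff_eq simp: diff\<close>)
  then show "J v - J u \<le> (x + z v) * \<Delta>"
    using J[of "x + z v"] by (simp add: right_diff_distrib)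
qed

text \<open>\<open>OU_weight lam t\<close> is the kernel in the representation of the integral of \<open>X\<close> over \<open>[0, t]\<close>
  as \<open>OU_weight lam t 0 * x0 + \<integral> OU_weight lam t s dZ\<^bsub>lam s\<^esub>\<close>, and \<open>OU_sum\<close> is the
  Riemann--Stieltjes sum of the last integral on \<open>n\<close> equal cells.\<close>

definition OU_weight :: "real \<Rightarrow> real \<Rightarrow> real \<Rightarrow> real" where
  "OU_weight lam t s = (1 - exp (- lam * (t - s))) / lam"

definition OU_sum :: "real \<Rightarrow> real \<Rightarrow> nat \<Rightarrow> (real \<Rightarrow> real) \<Rightarrow> real" where
  "OU_sum lam t n z = (\<Sum>k<n. OU_weight lam t (k * t / n) *
     (z (lam * (real (Suc k) * t / n)) - z (lam * (k * t / n))))"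

lemma OU_weight_antimono: "OU_weight lam t v \<le> OU_weight lam t u" if "lam > 0" "u \<le> v"
  using that by (simp add: OU_weight_def divide_right_mono)

lemma OU_weight_nonneg: "0 \<le> OU_weight lam t u" if "lam > 0" "u \<le> t"
  using OU_weight_antimono[OF that, of t] by (simp add: OU_weight_def)

text \<open>The kernel has slope \<open>- exp (- lam * (t - s))\<close>, of modulus at most 1 up to
  time \<open>t\<close>; the proof uses only \<open>1 + x \<le> exp x\<close>. This bound is the
  source of the factor \<open>t / n\<close> in the approximation error.\<close>

lemma OU_weight_diff_le: "OU_weight lam t u - OU_weight lam t v \<le> v - u"
  if "lam > 0" "u \<le> v" "v \<le> t"
proof -
  have "exp (- lam * (t - v)) - exp (- lam * (t - u)) = exp (- lam * (t - v)) * (1 - exp (- (lam * (v - u))))"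
    by (simp add: algebra_simps flip: exp_add)
  also have "\<dots> \<le> 1 * (lam * (v - u))"
    using exp_ge_add_one_self[of "- (lam * (v - u))"] that
    by (intro mult_mono) (auto simp: mult_nonneg_nonneg)
  finally have "(exp (- lam * (t - v)) - exp (- lam * (t - u))) / lam \<le> v - u"
    using that by (simp add: pos_divide_le_eq mult.commute)
  then show ?thesis
    by (simp add: OU_weight_def diff_divide_distrib)
qed

text \<open>On each cell \<open>OU_integral_bounds\<close> traps the increment of \<open>J\<close>.
  Scaled by \<open>exp (- lam * t)\<close> and summed, the increments telescope to the integral of
  \<open>X\<close>, and the bounds become sums of left or right end values of \<open>z\<close>
  against the decrements of the kernel. The upper sum is \<open>OU_sum\<close> after summation by
  parts. It exceeds the lower one by at most \<open>t / n * z (lam * t)\<close>, because each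
  decrement is at most \<open>t / n\<close> and the increments of \<open>z\<close>
  telescope.\<close>

lemma OU_integral_approx:
  fixes X z :: "real \<Rightarrow> real"
  assumes "lam > 0" "t > 0" "n > 0"
    and X: "X integrable_on {0..t}"
    and eq: "\<And>s. 0 \<le> s \<Longrightarrow> s \<le> t \<Longrightarrow> X s = x - lam * integral {0..s} X + z (lam * s)"
    and mono: "mono_on {0..} z" and z0: "z 0 = 0"
  shows "\<bar>integral {0..t} X - OU_weight lam t 0 * x - OU_sum lam t n z\<bar> \<le> t / n * z (lam * t)"
proof -
  define \<tau> where "\<tau> k = real k * t / real n" for k
  define g where "g k = OU_weight lam t (\<tau> k)" for k
  define y where "y k = z (lam * \<tau> k)" for k
  define J where "J s = exp (lam * s) * integral {0..s} X" for s
  define e where "e = exp (- lam * t)"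
  have \<tau>: "\<tau> 0 = 0" "\<tau> n = t" "\<tau> (Suc k) - \<tau> k = t / n" for k
    using \<open>n > 0\<close> by (simp_all add: \<tau>_def field_simps)
  have \<tau>_mono: "\<tau> k \<le> \<tau> (Suc k)" and \<tau>_nonneg: "0 \<le> \<tau> k" for k
    using \<open>t > 0\<close> by (auto simp: \<tau>_def intro!: divide_right_mono)
  have \<tau>_le: "\<tau> (Suc k) \<le> t" if "k < n" for k
  proof -
    have "real (Suc k) * t \<le> real n * t"
      using that \<open>t > 0\<close> by (intro mult_right_mono) auto
    then show ?thesis using \<open>n > 0\<close> by (simp add: \<tau>_def pos_divide_le_eq mult.commute)
  qed
  \<comment> \<open>The factor \<open>\<Delta>\<close> of \<open>OU_integral_bounds\<close>,
    discounted to time \<open>t\<close>, is exactly the decrement of the kernel over the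
    cell.\<close>
  have gd: "e * ((exp (lam * \<tau> (Suc k)) - exp (lam * \<tau> k)) / lam) = g k - g (Suc k)" for k
    by (simp add: e_def g_def OU_weight_def algebra_simps diff_divide_distrib flip: exp_add)
  have gd_nonneg: "0 \<le> g k - g (Suc k)" for k
    using OU_weight_antimono[OF \<open>lam > 0\<close> \<tau>_mono] by (simp add: g_def)
  have y_mono: "y k \<le> y (Suc k)" for k
    unfolding y_def using \<tau>_mono \<tau>_nonneg \<open>lam > 0\<close> by (intro mono_onD[OF mono]) auto
  have bounds: "(x + y k) * (g k - g (Suc k)) \<le> e * (J (\<tau> (Suc k)) - J (\<tau> k))"
    "e * (J (\<tau> (Suc k)) - J (\<tau> k)) \<le> (x + y (Suc k)) * (g k - g (Suc k))" if "k < n" for k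
  proof -
    have Xk: "X integrable_on {0..\<tau> (Suc k)}"
      by (rule integrable_subinterval_real[OF X]) (use \<tau>_le[OF that] in auto)
    have mk: "mono_on {0..\<tau> (Suc k)} (\<lambda>s. z (lam * s))"
      using mono \<open>lam > 0\<close> by (auto simp: mono_on_def)
    have eqk: "X s = x - lam * integral {0..s} X + z (lam * s)" if "0 \<le> s" "s \<le> \<tau> (Suc k)" for s
      using eq[of s] that \<tau>_le[OF \<open>k < n\<close>] by simp
    note B = OU_integral_bounds[OF \<open>lam > 0\<close> \<tau>_nonneg[of k] \<tau>_mono Xk eqk mk]
    have [simp]: "0 < e" by (simp add: e_def)
    from mult_left_mono[OF B(1), of e] show "(x + y k) * (g k - g (Suc k)) \<le> e * (J (\<tau> (Suc k)) - J (\<tau> k))"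
      unfolding gd[symmetric] J_def y_def
      by (simp only: mult.left_commute[of _ e] less_imp_le \<open>0 < e\<close>)
    from mult_left_mono[OF B(2), of e] show "e * (J (\<tau> (Suc k)) - J (\<tau> k)) \<le> (x + y (Suc k)) * (g k - g (Suc k))"
      unfolding gd[symmetric] J_def y_def
      by (simp only: mult.left_commute[of _ e] less_imp_le \<open>0 < e\<close>)
  qed
  have "(\<Sum>k<n. e * (J (\<tau> (Suc k)) - J (\<tau> k))) = e * (J (\<tau> n) - J (\<tau> 0))"
    using sum_lessThan_telescope[of "\<lambda>k. J (\<tau> k)" n] by (simp flip: sum_distrib_left)
  also have "\<dots> = integral {0..t} X"
    by (simp add: \<tau> J_def e_def flip: exp_add mult.assoc)
  finally have sumJ: "(\<Sum>k<n. e * (J (\<tau> (Suc k)) - J (\<tau> k))) = integral {0..t} X" .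
  have g0: "g 0 = OU_weight lam t 0" and gn: "g n = 0" and y0: "y 0 = 0" and yn: "y n = z (lam * t)"
    using z0 by (simp_all add: g_def y_def \<tau> OU_weight_def)
  have sum_x: "(\<Sum>k<n. (x + w k) * (g k - g (Suc k))) =
      OU_weight lam t 0 * x + (\<Sum>k<n. w k * (g k - g (Suc k)))" for w
    using sum_lessThan_telescope'[of g n]
    by (simp add: distrib_right sum.distrib g0 gn flip: sum_distrib_left)
  have lo: "OU_weight lam t 0 * x + (\<Sum>k<n. y k * (g k - g (Suc k))) \<le> integral {0..t} X"
    unfolding sumJ[symmetric] sum_x[symmetric] by (rule sum_mono) (use bounds in auto)
  have hi: "integral {0..t} X \<le> OU_weight lam t 0 * x + (\<Sum>k<n. y (Suc k) * (g k - g (Suc k)))"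
    unfolding sumJ[symmetric] sum_x[symmetric, of "\<lambda>k. y (Suc k)"] by (rule sum_mono) (use bounds in auto)
  \<comment> \<open>Summation by parts. The boundary terms vanish because the kernel is 0 at time
    \<open>t\<close> and \<open>z\<close> starts at 0.\<close>
  have abel: "(\<Sum>k<n. y (Suc k) * (g k - g (Suc k))) = OU_sum lam t n z"
  proof -
    have "(\<Sum>k<n. y (Suc k) * (g k - g (Suc k)))
        = (\<Sum>k<n. g k * (y (Suc k) - y k)) + (\<Sum>k<n. g k * y k - g (Suc k) * y (Suc k))"
      unfolding sum.distrib[symmetric] by (simp add: algebra_simps)
    also have "(\<Sum>k<n. g k * y k - g (Suc k) * y (Suc k)) = 0"
      using sum_lessThan_telescope'[of "\<lambda>k. g k * y k" n] by (simp add: gn y0)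
    finally show ?thesis
      by (simp add: OU_sum_def g_def y_def \<tau>_def)
  qed
  have "(\<Sum>k<n. y (Suc k) * (g k - g (Suc k))) - (\<Sum>k<n. y k * (g k - g (Suc k)))
      = (\<Sum>k<n. (y (Suc k) - y k) * (g k - g (Suc k)))"
    by (simp add: sum_subtractf left_diff_distrib)
  also have "\<dots> \<le> (\<Sum>k<n. (y (Suc k) - y k) * (t / n))"
  proof (rule sum_mono)
    fix k assume "k \<in> {..<n}"
    then show "(y (Suc k) - y k) * (g k - g (Suc k)) \<le> (y (Suc k) - y k) * (t / n)"
      using OU_weight_diff_le[OF \<open>lam > 0\<close> \<tau>_mono \<tau>_le, of k] \<tau>(3)[of k] y_mono[of k]
      by (intro mult_left_mono) (auto simp: g_def)
  qed
  also have "\<dots> = t / n * z (lam * t)"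
    by (simp add: sum_lessThan_telescope y0 yn flip: sum_distrib_right sum_divide_distrib)
  finally show ?thesis using lo hi abel by linarith
qed

text \<open>By the mean value theorem each increment of \<open>F\<close> lies between the end values
  of \<open>f\<close> times the cell length. The left and right sums therefore enclose
  \<open>F t - F 0\<close>, and they differ by the telescoping amount
  \<open>t / n * (f 0 - f t)\<close>. Writing \<open>Suc n\<close> keeps the number of cells
  positive.\<close>

lemma riemann_sum_antimono:
  fixes f F :: "real \<Rightarrow> real" and t :: real
  assumes "t > 0"
    and F: "\<And>s. 0 \<le> s \<Longrightarrow> s \<le> t \<Longrightarrow> (F has_real_derivative f s) (at s)"
    and anti: "\<And>u v. 0 \<le> u \<Longrightarrow> u \<le> v \<Longrightarrow> v \<le> t \<Longrightarrow> f v \<le> f u"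
  shows "(\<lambda>n. \<Sum>k<Suc n. f (k * t / Suc n) * (t / Suc n)) \<longlonglongrightarrow> F t - F 0"
proof -
  have bound: "\<bar>(\<Sum>k<n. f (k * t / n) * (t / n)) - (F t - F 0)\<bar> \<le> t / n * (f 0 - f t)" if "n > 0" for n :: nat
  proof -
    define \<tau> where "\<tau> k = real k * t / real n" for k
    have \<tau>: "\<tau> 0 = 0" "\<tau> n = t" "\<tau> (Suc k) - \<tau> k = t / n" for k
      using \<open>n > 0\<close> by (simp_all add: \<tau>_def field_simps)
    have \<tau>_less: "\<tau> k < \<tau> (Suc k)" and \<tau>_nonneg: "0 \<le> \<tau> k" for k
      using \<open>t > 0\<close> \<open>n > 0\<close> by (auto simp: \<tau>_def intro!: divide_strict_right_mono)
    have \<tau>_le: "\<tau> (Suc k) \<le> t" if "k < n" for k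
    proof -
      have "real (Suc k) * t \<le> real n * t"
        using that \<open>t > 0\<close> by (intro mult_right_mono) auto
      then show ?thesis using \<open>n > 0\<close> by (simp add: \<tau>_def pos_divide_le_eq mult.commute)
    qed
    have cell: "F (\<tau> (Suc k)) - F (\<tau> k) \<le> f (\<tau> k) * (t / n)"
      "f (\<tau> (Suc k)) * (t / n) \<le> F (\<tau> (Suc k)) - F (\<tau> k)" if "k < n" for k
    proof -
      obtain \<xi> where \<xi>: "\<tau> k < \<xi>" "\<xi> < \<tau> (Suc k)"
        and eq: "F (\<tau> (Suc k)) - F (\<tau> k) = (\<tau> (Suc k) - \<tau> k) * f \<xi>"
        using MVT2[OF \<tau>_less, of k F f] F \<tau>_nonneg[of k] \<tau>_le[OF \<open>k < n\<close>] by auto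
      show "F (\<tau> (Suc k)) - F (\<tau> k) \<le> f (\<tau> k) * (t / n)"
        "f (\<tau> (Suc k)) * (t / n) \<le> F (\<tau> (Suc k)) - F (\<tau> k)"
        unfolding eq \<tau>(3) mult.commute[of "t / n"]
        using \<xi> \<tau>_nonneg[of k] \<tau>_le[OF that] \<open>t > 0\<close> by (auto intro!: mult_right_mono divide_right_mono anti)
    qed
    have S: "(\<Sum>k<n. F (\<tau> (Suc k)) - F (\<tau> k)) = F t - F 0"
      using sum_lessThan_telescope[of "\<lambda>k. F (\<tau> k)" n] by (simp add: \<tau>)
    have hi: "F t - F 0 \<le> (\<Sum>k<n. f (\<tau> k) * (t / n))"
      unfolding S[symmetric] by (rule sum_mono) (use cell in auto)
    have lo: "(\<Sum>k<n. f (\<tau> (Suc k)) * (t / n)) \<le> F t - F 0"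
      unfolding S[symmetric] by (rule sum_mono) (use cell in auto)
    have "(\<Sum>k<n. f (\<tau> k) * (t / n)) - (\<Sum>k<n. f (\<tau> (Suc k)) * (t / n)) = (\<Sum>k<n. f (\<tau> k) - f (\<tau> (Suc k))) * (t / n)"
      by (simp add: sum_subtractf left_diff_distrib sum_distrib_right sum_divide_distrib diff_divide_distrib)
    also have "\<dots> = t / n * (f 0 - f t)"
      using sum_lessThan_telescope'[of "\<lambda>k. f (\<tau> k)" n] by (simp add: \<tau>)
    finally show ?thesis using hi lo unfolding \<tau>_def by linarith
  qed
  have "(\<lambda>n. t * (f 0 - f t) * inverse (real (Suc n))) \<longlonglongrightarrow> t * (f 0 - f t) * 0"
    by (intro tendsto_intros LIMSEQ_inverse_real_of_nat)
  then have "(\<lambda>n. t / real (Suc n) * (f 0 - f t)) \<longlonglongrightarrow> 0"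
    by (simp add: field_simps)
  moreover have "\<forall>\<^sub>F n in sequentially.
      norm ((\<Sum>k<Suc n. f (k * t / Suc n) * (t / Suc n)) - (F t - F 0)) \<le> t / real (Suc n) * (f 0 - f t)"
    unfolding real_norm_def by (intro always_eventually allI bound) simp
  ultimately have "(\<lambda>n. (\<Sum>k<Suc n. f (k * t / Suc n) * (t / Suc n)) - (F t - F 0)) \<longlonglongrightarrow> 0"
    by (rule Lim_null_comparison[rotated])
  then show ?thesis by (simp only: LIM_zero_iff)
qed

subsection \<open>Moments of limits and of linear combinations\<close>

lemma sum_power2_bound: "(u + v)\<^sup>2 \<le> 2 * u\<^sup>2 + 2 * v\<^sup>2" for u v :: real
  using zero_le_power2[of "u - v"] by (simp add: power2_eq_square algebra_simps)

text \<open>With \<open>C\<close> a bound for the null sequence \<open>c\<close>, the single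
  approximant \<open>R 0\<close> already makes \<open>Y\<close> square integrable. Conversely every
  \<open>R n\<close> is bounded by \<open>\<bar>Y\<bar> + C * \<bar>W\<bar>\<close>, which does not
  depend on \<open>n\<close>, so dominated convergence applies to first and second moments.\<close>

lemma (in prob_space) moments_of_dominated_limit:
  fixes Y W :: "'a \<Rightarrow> real" and R :: "nat \<Rightarrow> 'a \<Rightarrow> real"
  assumes [measurable]: "random_variable borel Y" "\<And>n. random_variable borel (R n)"
      "random_variable borel W"
    and R2: "integrable M (\<lambda>\<omega>. (R 0 \<omega>)\<^sup>2)" and W2: "integrable M (\<lambda>\<omega>. (W \<omega>)\<^sup>2)"
    and close: "\<And>n. AE \<omega> in M. \<bar>Y \<omega> - R n \<omega>\<bar> \<le> c n * W \<omega>" and c: "c \<longlonglongrightarrow> 0"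
  shows "integrable M (\<lambda>\<omega>. (Y \<omega>)\<^sup>2)"
    and "(\<lambda>n. expectation (R n)) \<longlonglongrightarrow> expectation Y"
    and "(\<lambda>n. expectation (\<lambda>\<omega>. (R n \<omega>)\<^sup>2)) \<longlonglongrightarrow> expectation (\<lambda>\<omega>. (Y \<omega>)\<^sup>2)"
proof -
  have "Bseq c" using c by (intro convergent_imp_Bseq convergentI)
  then obtain C where C: "C > 0" "\<And>n. \<bar>c n\<bar> \<le> C" unfolding Bseq_def by auto
  have W: "\<bar>c n * W \<omega>\<bar> \<le> C * \<bar>W \<omega>\<bar>" for n \<omega>
    using C(2)[of n] by (simp add: abs_mult mult_right_mono)
  show Y2: "integrable M (\<lambda>\<omega>. (Y \<omega>)\<^sup>2)"
  proof (rule Bochner_Integration.integrable_bound)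
    show "integrable M (\<lambda>\<omega>. 2 * (R 0 \<omega>)\<^sup>2 + 2 * (C\<^sup>2 * (W \<omega>)\<^sup>2))"
      using R2 W2 by auto
    show "AE \<omega> in M. norm ((Y \<omega>)\<^sup>2) \<le> norm (2 * (R 0 \<omega>)\<^sup>2 + 2 * (C\<^sup>2 * (W \<omega>)\<^sup>2))"
      using close[of 0]
    proof eventually_elim
      case (elim \<omega>)
      have "(Y \<omega> - R 0 \<omega>)\<^sup>2 \<le> (C * \<bar>W \<omega>\<bar>)\<^sup>2"
        using elim W[of 0 \<omega>] by (intro power2_le_iff_abs_le[THEN iffD2]) auto
      then show ?case
        using sum_power2_bound[of "R 0 \<omega>" "Y \<omega> - R 0 \<omega>"] by (simp add: power_mult_distrib)
    qed
  qed simp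
  have Y1: "integrable M Y" and W1: "integrable M W"
    by (rule square_integrable_imp_integrable[OF _ Y2] square_integrable_imp_integrable[OF _ W2], simp)+
  have R_lim: "AE \<omega> in M. (\<lambda>n. R n \<omega>) \<longlonglongrightarrow> Y \<omega>"
  proof -
    have "AE \<omega> in M. \<forall>n. \<bar>Y \<omega> - R n \<omega>\<bar> \<le> c n * W \<omega>"
      using close by (simp add: AE_all_countable)
    then show ?thesis
    proof eventually_elim
      case (elim \<omega>)
      have "(\<lambda>n. c n * W \<omega>) \<longlonglongrightarrow> 0 * W \<omega>"
        by (intro tendsto_intros c)
      then have "(\<lambda>n. c n * W \<omega>) \<longlonglongrightarrow> 0" by simp
      moreover have "\<forall>\<^sub>F n in sequentially. norm (Y \<omega> - R n \<omega>) \<le> c n * W \<omega>"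
        using elim by simp
      ultimately have "(\<lambda>n. Y \<omega> - R n \<omega>) \<longlonglongrightarrow> 0"
        by (metis Lim_null_comparison)
      from tendsto_diff[OF tendsto_const[of "Y \<omega>"] this] show ?case by simp
    qed
  qed
  have R_bound: "AE \<omega> in M. \<bar>R n \<omega>\<bar> \<le> \<bar>Y \<omega>\<bar> + C * \<bar>W \<omega>\<bar>" for n
    using close[of n]
  proof eventually_elim
    case (elim \<omega>)
    then show ?case using W[of n \<omega>] by linarith
  qed
  show "(\<lambda>n. expectation (R n)) \<longlonglongrightarrow> expectation Y"
    by (rule integral_dominated_convergence[where w = "\<lambda>\<omega>. \<bar>Y \<omega>\<bar> + C * \<bar>W \<omega>\<bar>"])
       (use Y1 W1 R_lim R_bound in auto)
  show "(\<lambda>n. expectation (\<lambda>\<omega>. (R n \<omega>)\<^sup>2)) \<longlonglongrightarrow> expectation (\<lambda>\<omega>. (Y \<omega>)\<^sup>2)"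
  proof (rule integral_dominated_convergence[where w = "\<lambda>\<omega>. 2 * (Y \<omega>)\<^sup>2 + 2 * (C\<^sup>2 * (W \<omega>)\<^sup>2)"])
    show "AE \<omega> in M. (\<lambda>n. (R n \<omega>)\<^sup>2) \<longlonglongrightarrow> (Y \<omega>)\<^sup>2"
      using R_lim by eventually_elim (intro tendsto_intros)
    show "AE \<omega> in M. norm ((R n \<omega>)\<^sup>2) \<le> 2 * (Y \<omega>)\<^sup>2 + 2 * (C\<^sup>2 * (W \<omega>)\<^sup>2)" for n
      using R_bound[of n]
    proof eventually_elim
      case (elim \<omega>)
      then have "(R n \<omega>)\<^sup>2 \<le> (\<bar>Y \<omega>\<bar> + C * \<bar>W \<omega>\<bar>)\<^sup>2"
        using C(1) by (intro power2_le_iff_abs_le[THEN iffD2]) auto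
      also have "\<dots> \<le> 2 * \<bar>Y \<omega>\<bar>\<^sup>2 + 2 * (C * \<bar>W \<omega>\<bar>)\<^sup>2"
        by (rule sum_power2_bound)
      finally show ?case by (simp add: power_mult_distrib)
    qed
  qed (use Y2 W2 in auto)
qed

text \<open>The product expands into a double sum. Independence factorizes the expectations off the
  diagonal, and each diagonal term adds its variance to the product of means. Two families of
  coefficients are kept so that mixed moments of different matrix entries are covered.\<close>

lemma (in prob_space) indep_linear_combinations:
  fixes X :: "'i \<Rightarrow> 'a \<Rightarrow> real" and c d :: "'i \<Rightarrow> real"
  assumes "finite I" and indep: "indep_vars (\<lambda>_. borel) X I"
    and X2: "\<And>i. i \<in> I \<Longrightarrow> integrable M (\<lambda>\<omega>. (X i \<omega>)\<^sup>2)"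
  shows "integrable M (\<lambda>\<omega>. \<Sum>i\<in>I. c i * X i \<omega>)"
    and "expectation (\<lambda>\<omega>. \<Sum>i\<in>I. c i * X i \<omega>) = (\<Sum>i\<in>I. c i * expectation (X i))"
    and "integrable M (\<lambda>\<omega>. (\<Sum>i\<in>I. c i * X i \<omega>) * (\<Sum>i\<in>I. d i * X i \<omega>))"
    and "expectation (\<lambda>\<omega>. (\<Sum>i\<in>I. c i * X i \<omega>) * (\<Sum>i\<in>I. d i * X i \<omega>)) =
      (\<Sum>i\<in>I. c i * expectation (X i)) * (\<Sum>i\<in>I. d i * expectation (X i)) +
      (\<Sum>i\<in>I. c i * d i * (expectation (\<lambda>\<omega>. (X i \<omega>)\<^sup>2) - (expectation (X i))\<^sup>2))"
proof -
  have rv: "random_variable borel (X i)" if "i \<in> I" for i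
    using indep that by (auto simp: indep_vars_def2)
  have X1: "integrable M (X i)" if "i \<in> I" for i
    by (rule square_integrable_imp_integrable[OF rv[OF that] X2[OF that]])
  show "integrable M (\<lambda>\<omega>. \<Sum>i\<in>I. c i * X i \<omega>)"
    "expectation (\<lambda>\<omega>. \<Sum>i\<in>I. c i * X i \<omega>) = (\<Sum>i\<in>I. c i * expectation (X i))"
    using X1 by simp_all
  have prod: "integrable M (\<lambda>\<omega>. X i \<omega> * X j \<omega>) \<and> expectation (\<lambda>\<omega>. X i \<omega> * X j \<omega>) =
      expectation (X i) * expectation (X j) +
      (if i = j then expectation (\<lambda>\<omega>. (X i \<omega>)\<^sup>2) - (expectation (X i))\<^sup>2 else 0)"
    if ij: "i \<in> I" "j \<in> I" for i j
  proof (cases "i = j")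
    case True
    with X2[OF ij(1)] show ?thesis by (simp add: power2_eq_square)
  next
    case False
    have ind: "indep_vars (\<lambda>_. borel) X {i, j}"
      by (rule indep_vars_subset[OF indep]) (use ij in auto)
    from indep_vars_integrable[OF _ ind] indep_vars_lebesgue_integral[OF _ ind] X1 ij False
    show ?thesis by auto
  qed
  have eq: "(\<Sum>i\<in>I. c i * X i \<omega>) * (\<Sum>i\<in>I. d i * X i \<omega>) = (\<Sum>i\<in>I. \<Sum>j\<in>I. c i * d j * (X i \<omega> * X j \<omega>))" for \<omega>
    by (simp add: sum_product mult_ac)
  show "integrable M (\<lambda>\<omega>. (\<Sum>i\<in>I. c i * X i \<omega>) * (\<Sum>i\<in>I. d i * X i \<omega>))"
    unfolding eq using prod by auto
  have "expectation (\<lambda>\<omega>. \<Sum>i\<in>I. \<Sum>j\<in>I. c i * d j * (X i \<omega> * X j \<omega>)) =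
      (\<Sum>i\<in>I. \<Sum>j\<in>I. c i * d j * expectation (\<lambda>\<omega>. X i \<omega> * X j \<omega>))"
    using prod[THEN conjunct1] by simp
  also have "\<dots> =
      (\<Sum>i\<in>I. \<Sum>j\<in>I. c i * d j * (expectation (X i) * expectation (X j)) +
        (if i = j then c i * d j * (expectation (\<lambda>\<omega>. (X i \<omega>)\<^sup>2) - (expectation (X i))\<^sup>2) else 0))"
    by (intro sum.cong refl) (simp add: prod[THEN conjunct2] distrib_left)
  also have "\<dots> = (\<Sum>i\<in>I. c i * expectation (X i)) * (\<Sum>i\<in>I. d i * expectation (X i)) +
      (\<Sum>i\<in>I. c i * d i * (expectation (\<lambda>\<omega>. (X i \<omega>)\<^sup>2) - (expectation (X i))\<^sup>2))"
    using \<open>finite I\<close> by (simp add: sum.distrib sum_product mult_ac sum.delta')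
  finally show "expectation (\<lambda>\<omega>. (\<Sum>i\<in>I. c i * X i \<omega>) * (\<Sum>i\<in>I. d i * X i \<omega>)) =
      (\<Sum>i\<in>I. c i * expectation (X i)) * (\<Sum>i\<in>I. d i * expectation (X i)) +
      (\<Sum>i\<in>I. c i * d i * (expectation (\<lambda>\<omega>. (X i \<omega>)\<^sup>2) - (expectation (X i))\<^sup>2))"
    unfolding eq .
qed

subsection \<open>Moments of the integrated process\<close>

text \<open>The increments over equal cells are independent and all have the law of
  \<open>Z h\<close> with \<open>h = lam * (t / n)\<close>, hence mean \<open>h * a / b\<close> and
  variance \<open>h * a / b^3\<close>. Mean and variance of the sum are thus Riemann sums of the
  kernel and of its square.\<close>

lemma (in prob_space) OU_sum_IG_moments:
  fixes a b lam t :: real and n :: nat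
  assumes Z: "IG_subordinator M a b Z" and "b > 0" "lam > 0" "t > 0" "n > 0"
  defines "R \<equiv> (\<lambda>\<omega>. OU_sum lam t n (\<lambda>s. Z s \<omega>))"
  shows "random_variable borel R" and "integrable M (\<lambda>\<omega>. (R \<omega>)\<^sup>2)"
    and "expectation R = lam * a / b * (\<Sum>k<n. OU_weight lam t (k * t / n) * (t / n))"
    and "expectation (\<lambda>\<omega>. (R \<omega>)\<^sup>2) = (expectation R)\<^sup>2 +
      lam * a / b ^ 3 * (\<Sum>k<n. (OU_weight lam t (k * t / n))\<^sup>2 * (t / n))"
proof -
  have levy: "levy_process M Z"
    using Z by (simp add: IG_subordinator_def subordinator_def)
  then have rv: "random_variable borel (Z s)" if "s \<ge> 0" for s
    using that by (simp add: levy_process_def)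
  define \<tau> where "\<tau> k = lam * (real k * t / real n)" for k
  define h where "h = lam * (t / real n)"
  have h: "h \<ge> 0" and \<tau>_nonneg: "\<tau> k \<ge> 0" and \<tau>_Suc: "\<tau> (Suc k) = \<tau> k + h" for k
    using assms by (simp_all add: \<tau>_def h_def field_simps)
  have \<tau>_mono: "\<forall>k<n. \<tau> k \<le> \<tau> (Suc k)"
    using h by (simp add: \<tau>_Suc)
  define X where "X k \<omega> = Z (\<tau> (Suc k)) \<omega> - Z (\<tau> k) \<omega>" for k \<omega>
  define g where "g k = OU_weight lam t (k * t / n)" for k :: nat
  have [measurable]: "random_variable borel (X k)" for k
    unfolding X_def using rv \<tau>_nonneg by simp
  have [measurable]: "random_variable borel (Z h)"
    using rv h by simp
  have indep: "indep_vars (\<lambda>_. borel) X {..<n}"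
  proof -
    have "\<And>n (\<tau> :: nat \<Rightarrow> real). 0 \<le> \<tau> 0 \<Longrightarrow> \<forall>k<n. \<tau> k \<le> \<tau> (Suc k) \<Longrightarrow>
        indep_vars (\<lambda>_. borel) (\<lambda>k \<omega>. Z (\<tau> (Suc k)) \<omega> - Z (\<tau> k) \<omega>) {..<n}"
      using levy by (simp add: levy_process_def)
    from this[of \<tau> n] show ?thesis
      unfolding X_def[abs_def] using \<tau>_nonneg[of 0] \<tau>_mono by blast
  qed
  have distr: "distr M borel (X k) = distr M borel (Z h)" for k
  proof -
    have "distr M borel (\<lambda>\<omega>. Z (\<tau> k + h) \<omega> - Z (\<tau> k) \<omega>) = distr M borel (Z h)"
      using levy \<tau>_nonneg[of k] h by (simp add: levy_process_def)
    then show ?thesis unfolding X_def[abs_def] \<tau>_Suc .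
  qed
  \<comment> \<open>Integrability and expectation depend on the law alone, so the moments of
    \<open>Z h\<close> carry over to every increment.\<close>
  have transfer: "integrable M (\<lambda>\<omega>. f (X k \<omega>)) \<longleftrightarrow> integrable M (\<lambda>\<omega>. f (Z h \<omega>))"
    "expectation (\<lambda>\<omega>. f (X k \<omega>)) = expectation (\<lambda>\<omega>. f (Z h \<omega>))"
    if "f \<in> borel_measurable borel" for f :: "real \<Rightarrow> real" and k
  proof -
    have "integrable (distr M borel (X k)) f \<longleftrightarrow> integrable M (\<lambda>\<omega>. f (X k \<omega>))"
      "integrable (distr M borel (Z h)) f \<longleftrightarrow> integrable M (\<lambda>\<omega>. f (Z h \<omega>))"
      by (rule integrable_distr_eq; use that in measurable)+
    then show "integrable M (\<lambda>\<omega>. f (X k \<omega>)) \<longleftrightarrow> integrable M (\<lambda>\<omega>. f (Z h \<omega>))"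
      unfolding distr by simp
    have "integral\<^sup>L (distr M borel (X k)) f = expectation (\<lambda>\<omega>. f (X k \<omega>))"
      "integral\<^sup>L (distr M borel (Z h)) f = expectation (\<lambda>\<omega>. f (Z h \<omega>))"
      by (rule integral_distr; use that in measurable)+
    then show "expectation (\<lambda>\<omega>. f (X k \<omega>)) = expectation (\<lambda>\<omega>. f (Z h \<omega>))"
      unfolding distr by simp
  qed
  note m = IG_subordinator_moments[OF Z \<open>b > 0\<close> h]
  have X2: "integrable M (\<lambda>\<omega>. (X k \<omega>)\<^sup>2)" for k
    using m(1) transfer(1)[of "\<lambda>x. x\<^sup>2"] by simp
  have EX2: "expectation (\<lambda>\<omega>. (X k \<omega>)\<^sup>2) = (h * a / b)\<^sup>2 + h * a / b ^ 3" for k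
    using m(2) transfer(2)[of "\<lambda>x. x\<^sup>2"] by simp
  have EX: "expectation (X k) = h * a / b" for k
    using m(3) transfer(2)[of "\<lambda>x. x"] by simp
  have R: "R = (\<lambda>\<omega>. \<Sum>k<n. g k * X k \<omega>)"
    by (simp add: R_def OU_sum_def g_def X_def \<tau>_def)
  show "random_variable borel R"
    unfolding R by measurable
  note L2 = indep_linear_combinations(2)[OF finite_lessThan indep X2, of g]
  note L34 = indep_linear_combinations(3,4)[OF finite_lessThan indep X2, of g g, folded power2_eq_square]
  show "integrable M (\<lambda>\<omega>. (R \<omega>)\<^sup>2)"
    unfolding R by (rule L34(1))
  show ER: "expectation R = lam * a / b * (\<Sum>k<n. OU_weight lam t (k * t / n) * (t / n))"
    unfolding R L2 by (simp add: EX g_def h_def sum_distrib_left mult_ac)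
  have "expectation (\<lambda>\<omega>. (R \<omega>)\<^sup>2) = (expectation R)\<^sup>2 + (\<Sum>k<n. (g k)\<^sup>2 * (h * a / b ^ 3))"
    unfolding R L34(2) L2 by (simp add: EX EX2)
  then show "expectation (\<lambda>\<omega>. (R \<omega>)\<^sup>2) = (expectation R)\<^sup>2 +
      lam * a / b ^ 3 * (\<Sum>k<n. (OU_weight lam t (k * t / n))\<^sup>2 * (t / n))"
    by (simp add: g_def h_def sum_distrib_left mult_ac)
qed

text \<open>The limits are the integrals over \<open>{0..t}\<close> of the kernel and of its square,
  both nonincreasing there, evaluated by explicit antiderivatives.\<close>

lemma OU_weight_integral_limits:
  fixes lam t :: real
  assumes "lam > 0" "t > 0"
  shows "(\<lambda>n. \<Sum>k<Suc n. OU_weight lam t (k * t / Suc n) * (t / Suc n)) \<longlonglongrightarrow>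
      (lam * t - (1 - exp (- lam * t))) / lam\<^sup>2" (is ?A)
    and "(\<lambda>n. \<Sum>k<Suc n. (OU_weight lam t (k * t / Suc n))\<^sup>2 * (t / Suc n)) \<longlonglongrightarrow>
      (lam * t - 2 * (1 - exp (- lam * t)) + 1 / 2 * (1 - exp (- 2 * lam * t))) / lam ^ 3" (is ?B)
proof -
  define E where "E s = exp (- lam * (t - s))" for s
  have dE: "(E has_real_derivative lam * E s) (at s)" for s
    unfolding E_def by (auto intro!: derivative_eq_intros)
  have w: "OU_weight lam t s = (1 - E s) / lam" for s
    by (simp add: OU_weight_def E_def)
  have Et: "E t = 1" and E0: "E 0 = exp (- lam * t)" and E02: "exp (- 2 * lam * t) = (E 0)\<^sup>2"
    by (simp_all add: E_def power2_eq_square flip: exp_add)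
  have "(\<lambda>n. \<Sum>k<Suc n. OU_weight lam t (k * t / Suc n) * (t / Suc n)) \<longlonglongrightarrow>
      (\<lambda>s. (s - E s / lam) / lam) t - (\<lambda>s. (s - E s / lam) / lam) 0"
  proof (rule riemann_sum_antimono[OF \<open>t > 0\<close>])
    show "((\<lambda>s. (s - E s / lam) / lam) has_real_derivative OU_weight lam t s) (at s)" for s
      unfolding w using \<open>lam > 0\<close> by (auto intro!: derivative_eq_intros dE)
  qed (use OU_weight_antimono[OF \<open>lam > 0\<close>] in auto)
  also have "(\<lambda>s. (s - E s / lam) / lam) t - (\<lambda>s. (s - E s / lam) / lam) 0 =
      (lam * t - (1 - exp (- lam * t))) / lam\<^sup>2"
    unfolding E0[symmetric] using \<open>lam > 0\<close> by (simp add: Et field_simps power2_eq_square)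
  finally show ?A .
  \<comment> \<open>Termwise antiderivative of \<open>(1 - 2 * E + E^2) / lam^2\<close>, using
    \<open>E' = lam * E\<close>.\<close>
  define F where "F s = (s - 2 * E s / lam + (E s)\<^sup>2 / (2 * lam)) / lam\<^sup>2" for s
  have "(\<lambda>n. \<Sum>k<Suc n. (OU_weight lam t (k * t / Suc n))\<^sup>2 * (t / Suc n)) \<longlonglongrightarrow> F t - F 0"
  proof (rule riemann_sum_antimono[OF \<open>t > 0\<close>])
    show "(F has_real_derivative (OU_weight lam t s)\<^sup>2) (at s)" for s
      unfolding w F_def using \<open>lam > 0\<close>
      by (auto intro!: derivative_eq_intros dE simp: field_simps power2_eq_square)
    show "(OU_weight lam t v)\<^sup>2 \<le> (OU_weight lam t u)\<^sup>2" if "0 \<le> u" "u \<le> v" "v \<le> t" for u v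
      using that OU_weight_antimono[OF \<open>lam > 0\<close>] OU_weight_nonneg[OF \<open>lam > 0\<close>]
      by (intro power_mono) auto
  qed
  also have "F t - F 0 =
      (lam * t - 2 * (1 - exp (- lam * t)) + 1 / 2 * (1 - exp (- 2 * lam * t))) / lam ^ 3"
    unfolding E02 unfolding E0[symmetric] F_def using \<open>lam > 0\<close>
    by (simp add: Et field_simps power2_eq_square power3_eq_cube)
  finally show ?B .
qed

text \<open>Measurability of a parameter integral. Since \<open>X\<close> is jointly measurable only
  for times \<open>s \<ge> 0\<close>, time is first replaced by \<open>max 0 s\<close>, which
  changes nothing on \<open>{0..t}\<close>.\<close>

lemma OU_solution_integral_measurable:
  assumes "OU_solution M lam Z x X"
  shows "(\<lambda>\<omega>. LINT s:{0..t}|lborel. X s \<omega>) \<in> borel_measurable M"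
proof -
  have X: "case_prod X \<in> borel_measurable (restrict_space borel {0..} \<Otimes>\<^sub>M M)"
    using assms by (simp add: OU_solution_def)
  have "(\<lambda>(\<omega>, s :: real). (max 0 s, \<omega>)) \<in> M \<Otimes>\<^sub>M lborel \<rightarrow>\<^sub>M restrict_space borel {0..} \<Otimes>\<^sub>M M"
    by (auto simp: case_prod_beta' intro!: measurable_Pair measurable_restrict_space2 borel_measurable_max)
  from measurable_compose[OF this X]
  have [measurable]: "(\<lambda>(\<omega>, s). X (max 0 s) \<omega>) \<in> borel_measurable (M \<Otimes>\<^sub>M lborel)"
    by (simp add: case_prod_beta')
  have "(\<lambda>\<omega>. \<integral>s. indicator {0..t} s * X (max 0 s) \<omega> \<partial>lborel) \<in> borel_measurable M"
    by measurable
  also have "(\<lambda>\<omega>. \<integral>s. indicator {0..t} s * X (max 0 s) \<omega> \<partial>lborel) = (\<lambda>\<omega>. LINT s:{0..t}|lborel. X s \<omega>)"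
    unfolding set_lebesgue_integral_def
    by (intro ext Bochner_Integration.integral_cong) (auto simp: indicator_def)
  finally show ?thesis .
qed

text \<open>The pathwise error \<open>t / Suc n * Z (lam * t)\<close> is a null sequence times a
  square integrable variable, so the moments of the sums converge to those of the integral. The
  almost sure limit in the last conclusion exhibits the integral as a function of the path of
  \<open>Z\<close>, through which independence is inherited.\<close>

lemma (in prob_space) OU_integral_IG:
  fixes a b lam t x :: real
  assumes Z: "IG_subordinator M a b Z" and "b > 0" "lam > 0" "t > 0"
    and X: "OU_solution M lam Z x X"
  defines "Y \<equiv> (\<lambda>\<omega>. LINT s:{0..t}|lborel. X s \<omega>)"
  shows "integrable M (\<lambda>\<omega>. (Y \<omega>)\<^sup>2)"
    and "expectation Y = inverse lam * (1 - exp (- lam * t)) * x +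
      a / (lam * b) * (lam * t - (1 - exp (- lam * t)))"
    and "expectation (\<lambda>\<omega>. (Y \<omega>)\<^sup>2) - (expectation Y)\<^sup>2 = a / (lam\<^sup>2 * b ^ 3) *
      (lam * t - 2 * (1 - exp (- lam * t)) + 1 / 2 * (1 - exp (- 2 * lam * t)))"
    and "AE \<omega> in M. (\<lambda>n. OU_weight lam t 0 * x + OU_sum lam t (Suc n) (\<lambda>s. Z s \<omega>)) \<longlonglongrightarrow> Y \<omega>"
proof -
  have levy: "levy_process M Z" and mono: "AE \<omega> in M. mono_on {0..} (\<lambda>s. Z s \<omega>)"
    using Z by (simp_all add: IG_subordinator_def subordinator_def)
  have rv_Zt [measurable]: "random_variable borel (Z (lam * t))"
    using levy assms by (simp add: levy_process_def)
  have rv_Y [measurable]: "random_variable borel Y"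
    unfolding Y_def by (rule OU_solution_integral_measurable[OF X])
  define \<phi> where "\<phi> = OU_weight lam t 0 * x"
  define R where "R n \<omega> = OU_sum lam t (Suc n) (\<lambda>s. Z s \<omega>)" for n \<omega>
  have close: "AE \<omega> in M. \<forall>n. \<bar>(Y \<omega> - \<phi>) - R n \<omega>\<bar> \<le> t / Suc n * Z (lam * t) \<omega>"
  proof -
    have Z0: "AE \<omega> in M. Z 0 \<omega> = 0"
      using levy by (simp add: levy_process_def)
    have "AE \<omega> in M. \<forall>t\<ge>0. set_integrable lborel {0..t} (\<lambda>s. X s \<omega>) \<and>
        X t \<omega> = x - lam * (LINT s:{0..t}|lborel. X s \<omega>) + Z (lam * t) \<omega>"
      using X by (simp add: OU_solution_def)
    then show ?thesis
      using Z0 mono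
    proof eventually_elim
      case (elim \<omega>)
      have LI: "(LINT s:{0..u}|lborel. X s \<omega>) = integral {0..u} (\<lambda>s. X s \<omega>)"
        and int: "(\<lambda>s. X s \<omega>) integrable_on {0..u}" if "u \<ge> 0" for u
        using set_borel_integral_eq_integral[of "{0..u}" "\<lambda>s. X s \<omega>"] elim(1) that by auto
      have "\<bar>integral {0..t} (\<lambda>s. X s \<omega>) - OU_weight lam t 0 * x - OU_sum lam t (Suc n) (\<lambda>s. Z s \<omega>)\<bar>
          \<le> t / Suc n * Z (lam * t) \<omega>" for n
      proof (rule OU_integral_approx[OF \<open>lam > 0\<close> \<open>t > 0\<close>])
        show "X s \<omega> = x - lam * integral {0..s} (\<lambda>s. X s \<omega>) + Z (lam * s) \<omega>" if "0 \<le> s" for s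
          using elim(1) that LI[OF that] by metis
      qed (use elim int[of t] \<open>t > 0\<close> in auto)
      then show ?case
        using LI[of t] \<open>t > 0\<close> by (simp add: Y_def \<phi>_def R_def)
    qed
  qed
  have R: "random_variable borel (R n)" "integrable M (\<lambda>\<omega>. (R n \<omega>)\<^sup>2)"
    "expectation (R n) = lam * a / b * (\<Sum>k<Suc n. OU_weight lam t (k * t / Suc n) * (t / Suc n))"
    "expectation (\<lambda>\<omega>. (R n \<omega>)\<^sup>2) = (expectation (R n))\<^sup>2 +
      lam * a / b ^ 3 * (\<Sum>k<Suc n. (OU_weight lam t (k * t / Suc n))\<^sup>2 * (t / Suc n))" for n
    using OU_sum_IG_moments[OF Z assms(2-4), of "Suc n"] unfolding R_def[abs_def] by auto
  have c: "(\<lambda>n. t / Suc n) \<longlonglongrightarrow> 0"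
    using tendsto_mult[OF tendsto_const[of t] LIMSEQ_inverse_real_of_nat] by (simp add: divide_inverse)
  have W2: "integrable M (\<lambda>\<omega>. (Z (lam * t) \<omega>)\<^sup>2)"
    using IG_subordinator_moments(1)[OF Z \<open>b > 0\<close>, of "lam * t"] assms by simp
  \<comment> \<open>Removing the deterministic contribution of the initial value shifts the mean and
    leaves the variance unchanged.\<close>
  define U where "U \<omega> = Y \<omega> - \<phi>" for \<omega>
  have rv_U: "random_variable borel U" unfolding U_def by simp
  have close_n: "AE \<omega> in M. \<bar>U \<omega> - R n \<omega>\<bar> \<le> t / Suc n * Z (lam * t) \<omega>" for n
    using close by eventually_elim (simp add: U_def)
  note lim = moments_of_dominated_limit[OF rv_U R(1) rv_Zt R(2) W2 close_n c]
  have Y_U: "Y = (\<lambda>\<omega>. U \<omega> + \<phi>)"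
    by (simp add: U_def)
  have sq: "(\<lambda>\<omega>. (Y \<omega>)\<^sup>2) = (\<lambda>\<omega>. (U \<omega>)\<^sup>2 + 2 * \<phi> * U \<omega> + \<phi>\<^sup>2)"
    by (simp add: Y_U power2_eq_square algebra_simps)
  have U1: "integrable M U"
    by (rule square_integrable_imp_integrable[OF rv_U lim(1)])
  show "integrable M (\<lambda>\<omega>. (Y \<omega>)\<^sup>2)"
    unfolding sq using lim(1) U1 by simp
  define m where "m = expectation U"
  have EY: "expectation Y = \<phi> + m"
    unfolding Y_U m_def using U1 by (simp add: prob_space)
  have EY2: "expectation (\<lambda>\<omega>. (Y \<omega>)\<^sup>2) = expectation (\<lambda>\<omega>. (U \<omega>)\<^sup>2) + 2 * \<phi> * m + \<phi>\<^sup>2"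
    unfolding sq m_def using lim(1) U1 by (simp add: prob_space)
  note S = OU_weight_integral_limits[OF \<open>lam > 0\<close> \<open>t > 0\<close>]
  have "(\<lambda>n. expectation (R n)) \<longlonglongrightarrow> lam * a / b * ((lam * t - (1 - exp (- lam * t))) / lam\<^sup>2)"
    unfolding R(3) by (intro tendsto_intros S)
  from LIMSEQ_unique[OF lim(2) this]
  have m: "m = a / (lam * b) * (lam * t - (1 - exp (- lam * t)))"
    unfolding m_def using \<open>lam > 0\<close> by (simp add: power2_eq_square)
  show "expectation Y = inverse lam * (1 - exp (- lam * t)) * x +
      a / (lam * b) * (lam * t - (1 - exp (- lam * t)))"
    unfolding EY m \<phi>_def OU_weight_def by (simp add: divide_inverse mult_ac)
  define v where "v = (lam * t - 2 * (1 - exp (- lam * t)) + 1 / 2 * (1 - exp (- 2 * lam * t))) / lam ^ 3"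
  have "(\<lambda>n. expectation (\<lambda>\<omega>. (R n \<omega>)\<^sup>2)) \<longlonglongrightarrow> m\<^sup>2 + lam * a / b ^ 3 * v"
    unfolding R(4) v_def m_def by (intro tendsto_intros S lim(2))
  from LIMSEQ_unique[OF lim(3) this]
  have "expectation (\<lambda>\<omega>. (Y \<omega>)\<^sup>2) - (expectation Y)\<^sup>2 = lam * a / b ^ 3 * v"
    unfolding EY EY2 by (simp add: power2_eq_square algebra_simps)
  also have "\<dots> = a / (lam\<^sup>2 * b ^ 3) *
      (lam * t - 2 * (1 - exp (- lam * t)) + 1 / 2 * (1 - exp (- 2 * lam * t)))"
    unfolding v_def using \<open>lam > 0\<close> by (simp add: power2_eq_square power3_eq_cube)
  finally show "expectation (\<lambda>\<omega>. (Y \<omega>)\<^sup>2) - (expectation Y)\<^sup>2 = a / (lam\<^sup>2 * b ^ 3) *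
      (lam * t - 2 * (1 - exp (- lam * t)) + 1 / 2 * (1 - exp (- 2 * lam * t)))" .
  show "AE \<omega> in M. (\<lambda>n. OU_weight lam t 0 * x + OU_sum lam t (Suc n) (\<lambda>s. Z s \<omega>)) \<longlonglongrightarrow> Y \<omega>"
    using close
  proof eventually_elim
    case (elim \<omega>)
    have "(\<lambda>n. t / Suc n * Z (lam * t) \<omega>) \<longlonglongrightarrow> 0 * Z (lam * t) \<omega>"
      by (intro tendsto_intros c)
    then have "(\<lambda>n. t / Suc n * Z (lam * t) \<omega>) \<longlonglongrightarrow> 0" by simp
    moreover have "\<forall>\<^sub>F n in sequentially. norm ((Y \<omega> - \<phi>) - R n \<omega>) \<le> t / Suc n * Z (lam * t) \<omega>"
      unfolding real_norm_def using elim by (intro always_eventually) 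
    ultimately have "(\<lambda>n. (Y \<omega> - \<phi>) - R n \<omega>) \<longlonglongrightarrow> 0"
      by (rule Lim_null_comparison[rotated])
    from tendsto_diff[OF tendsto_const[of "Y \<omega>"] this] show ?case
      by (simp add: \<phi>_def R_def)
  qed
qed

subsection \<open>The integrated covariance\<close>

text \<open>Independence is assumed for the paths of the drivers only; this limit turns the integral of \<open>X\<close>
  into a measurable function of the path of \<open>Z\<close>.\<close>

definition OU_functional :: "real \<Rightarrow> real \<Rightarrow> real \<Rightarrow> (real \<Rightarrow> real) \<Rightarrow> real" where
  "OU_functional lam t x z = lim (\<lambda>n. OU_weight lam t 0 * x + OU_sum lam t (Suc n) z)"

text \<open>Each sum reads finitely many coordinates of the path, all at nonnegative times, and
  \<open>lim\<close> of a sequence of measurable functions is measurable even where the sequence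
  diverges.\<close>

lemma OU_functional_measurable:
  assumes "lam > 0" "t > 0"
  shows "OU_functional lam t x \<in> borel_measurable (PiM {0..} (\<lambda>_. borel))"
proof -
  have "(\<lambda>z. OU_sum lam t n z) \<in> borel_measurable (PiM {0..} (\<lambda>_. borel))" for n
    unfolding OU_sum_def using assms
    by (intro borel_measurable_sum borel_measurable_times borel_measurable_diff borel_measurable_const
        measurable_component_singleton) auto
  then show ?thesis
    unfolding OU_functional_def[abs_def] by (intro borel_measurable_lim_metric borel_measurable_add) simp_all
qed

lemma OU_functional_restrict:
  assumes "lam > 0" "t > 0"
  shows "OU_functional lam t x (restrict z {0..}) = OU_functional lam t x z"
  using assms by (simp add: OU_functional_def OU_sum_def)

lemma UNIV_component_2: "(UNIV :: (component \<times> 2) set) = {(CF, 1), (CF, 2), (CV, 1), (CV, 2)}"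
proof -
  have "p \<in> {(CF, 1), (CF, 2), (CV, 1), (CV, 2)}" for p :: "component \<times> 2"
    by (cases p; cases "fst p") (use exhaust_2 in auto)
  then show ?thesis by auto
qed

theorem proposition3p2:
  fixes Q :: "'w measure"
    and lam a b :: "component \<Rightarrow> 2 \<Rightarrow> real"
    and Z :: "component \<Rightarrow> 2 \<Rightarrow> real \<Rightarrow> 'w \<Rightarrow> real"
    and F V :: "real \<Rightarrow> 'w \<Rightarrow> real ^ 2"
    and F0 V0 :: "real ^ 2"
    and A :: "real ^ 2 ^ 2"
    and t :: real
    and D D2 :: "component \<Rightarrow> 2 \<Rightarrow> complex"
    and \<phi> \<nu> :: "2 \<Rightarrow> real"
    and \<sigma> :: "2 \<Rightarrow> 2 \<Rightarrow> 'w \<Rightarrow> real"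
  assumes "prob_space Q"
    and "\<And>H l. lam H l > 0" and "\<And>H l. a H l > 0" and "\<And>H l. b H l > 0"
    and "\<And>H l. IG_subordinator Q (a H l) (b H l) (Z H l)"
    and "prob_space.indep_vars Q (\<lambda>_ :: component \<times> 2. PiM {0..} (\<lambda>_ :: real. borel))
           (\<lambda>(H, l) \<omega>. \<lambda>s\<in>{0..}. Z H l s \<omega>) UNIV"
    and "\<And>l. OU_solution Q (lam CF l) (Z CF l) (F0 $ l) (\<lambda>s \<omega>. F s \<omega> $ l)"
    and "\<And>l. OU_solution Q (lam CV l) (Z CV l) (V0 $ l) (\<lambda>s \<omega>. V s \<omega> $ l)"
    and "orthogonal_matrix A"
    and "t > 0"
    and "\<And>k j \<omega>. \<sigma> k j \<omega> = integrated_covariance A F V t \<omega> $ k $ j"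
    and "\<And>H l. D H l = \<i> * a H l / (lam H l * b H l) * (lam H l * t - (1 - exp (- lam H l * t)))"
    and "\<And>H l. D2 H l = - (a H l / ((lam H l)\<^sup>2 * (b H l) ^ 3)) *
           (lam H l * t - 2 * (1 - exp (- lam H l * t)) + 1 / 2 * (1 - exp (- 2 * lam H l * t)))"
    and "\<And>k. \<phi> k = inverse (lam CF k) * (1 - exp (- lam CF k * t)) * F0 $ k"
    and "\<And>l. \<nu> l = inverse (lam CV l) * (1 - exp (- lam CV l * t)) * V0 $ l"
  shows "(\<forall>k j. integrable Q (\<sigma> k j)) \<and>
    (\<forall>k j k' j'. integrable Q (\<lambda>\<omega>. \<sigma> k j \<omega> * \<sigma> k' j' \<omega>)) \<and>
    (\<forall>k. prob_space.expectation Q (\<sigma> k k) =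
       \<phi> k - \<i> * D CF k + (\<Sum>l\<in>UNIV. (A $ k $ l)\<^sup>2 * \<nu> l) - \<i> * (\<Sum>l\<in>UNIV. (A $ k $ l)\<^sup>2 * D CV l)) \<and>
    prob_space.expectation Q (\<sigma> 1 2) =
       (\<Sum>l\<in>UNIV. A $ 1 $ l * A $ 2 $ l * \<nu> l) - \<i> * (\<Sum>l\<in>UNIV. A $ 1 $ l * A $ 2 $ l * D CV l) \<and>
    (\<forall>k. prob_space.expectation Q (\<lambda>\<omega>. (\<sigma> k k \<omega>)\<^sup>2) =
       - (\<i> * \<phi> k + D CF k + \<i> * (\<Sum>l\<in>UNIV. (A $ k $ l)\<^sup>2 * \<nu> l)
            + (\<Sum>l\<in>UNIV. (A $ k $ l)\<^sup>2 * D CV l))\<^sup>2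
       - (D2 CF k + (\<Sum>l\<in>UNIV. (A $ k $ l) ^ 4 * D2 CV l))) \<and>
    prob_space.expectation Q (\<lambda>\<omega>. (\<sigma> 1 2 \<omega>)\<^sup>2) =
       - (\<Sum>l\<in>UNIV. (A $ 1 $ l)\<^sup>2 * (A $ 2 $ l)\<^sup>2 * D2 CV l)
       - (\<i> * (\<Sum>l\<in>UNIV. A $ 1 $ l * A $ 2 $ l * \<nu> l)
            + (\<Sum>l\<in>UNIV. A $ 1 $ l * A $ 2 $ l * D CV l))\<^sup>2 \<and>
    (\<forall>k. prob_space.expectation Q (\<lambda>\<omega>. \<sigma> k k \<omega> * \<sigma> 1 2 \<omega>) =
       - (\<Sum>l\<in>UNIV. (A $ k $ l)\<^sup>2 * A $ 1 $ l * A $ 2 $ l * D2 CV l)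
       - (\<i> * \<phi> k + D CF k + \<i> * (\<Sum>l\<in>UNIV. (A $ k $ l)\<^sup>2 * \<nu> l)
            + (\<Sum>l\<in>UNIV. (A $ k $ l)\<^sup>2 * D CV l))
         * (\<i> * (\<Sum>l\<in>UNIV. A $ 1 $ l * A $ 2 $ l * \<nu> l)
            + (\<Sum>l\<in>UNIV. A $ 1 $ l * A $ 2 $ l * D CV l))) \<and>
    prob_space.expectation Q (\<lambda>\<omega>. \<sigma> 1 1 \<omega> * \<sigma> 2 2 \<omega>) =
       - (\<Sum>l\<in>UNIV. (A $ 1 $ l)\<^sup>2 * (A $ 2 $ l)\<^sup>2 * D2 CV l)
       - (\<i> * \<phi> 1 + D CF 1 + \<i> * (\<Sum>l\<in>UNIV. (A $ 1 $ l)\<^sup>2 * \<nu> l)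
            + (\<Sum>l\<in>UNIV. (A $ 1 $ l)\<^sup>2 * D CV l))
         * (\<i> * \<phi> 2 + D CF 2 + \<i> * (\<Sum>l\<in>UNIV. (A $ 2 $ l)\<^sup>2 * \<nu> l)
            + (\<Sum>l\<in>UNIV. (A $ 2 $ l)\<^sup>2 * D CV l))"
proof -
  interpret prob_space Q by fact
  note lam = assms(2) and b = assms(4) and IG = assms(5) and t = \<open>t > 0\<close>

  \<comment> \<open>The four integrated processes as one independent family\<close>
  define x0 where "x0 H l = (case H of CF \<Rightarrow> F0 $ l | CV \<Rightarrow> V0 $ l)" for H l
  define X where "X H l s \<omega> = (case H of CF \<Rightarrow> F s \<omega> $ l | CV \<Rightarrow> V s \<omega> $ l)" for H l s \<omega>
  have OU: "OU_solution Q (lam H l) (Z H l) (x0 H l) (X H l)" for H l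
    using assms(7,8) by (cases H) (simp_all add: x0_def[abs_def] X_def[abs_def])
  define I where "I p \<omega> = (LINT s:{0..t}|lborel. X (fst p) (snd p) s \<omega>)" for p \<omega>
  \<comment> \<open>\<open>Y p\<close> agrees with \<open>I p\<close> almost surely but is a
    measurable function of the path of its driver alone, so independence of the drivers passes to
    the family \<open>Y\<close>.\<close>
  define Y where "Y p \<omega> = OU_functional (lam (fst p) (snd p)) t (x0 (fst p) (snd p))
    (\<lambda>s. Z (fst p) (snd p) s \<omega>)" for p \<omega>
  have indep: "indep_vars (\<lambda>_. borel) Y UNIV"
  proof -
    have "indep_vars (\<lambda>_. borel) (\<lambda>p \<omega>. OU_functional (lam (fst p) (snd p)) t (x0 (fst p) (snd p))
        ((case p of (H, l) \<Rightarrow> (\<lambda>\<omega>. \<lambda>s\<in>{0..}. Z H l s \<omega>)) \<omega>)) UNIV"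
      by (rule indep_vars_compose2[OF assms(6)]) (intro OU_functional_measurable lam t)
    then show ?thesis
      by (simp add: case_prod_beta' OU_functional_restrict lam t Y_def[abs_def])
  qed
  then have rvY [measurable]: "random_variable borel (Y p)" for p
    by (cases p) (simp add: indep_vars_def2)
  have rvI [measurable]: "random_variable borel (I p)" for p
    unfolding I_def by (rule OU_solution_integral_measurable[OF OU])
  note M = OU_integral_IG[OF IG b lam t OU]
  have AE_eq: "AE \<omega> in Q. Y p \<omega> = I p \<omega>" for p
    using M(4)[of "fst p" "snd p"]
    by eventually_elim (simp add: Y_def I_def OU_functional_def limI)

  \<comment> \<open>Means and variances of the four integrals\<close>
  define d where "d H l = a H l / (lam H l * b H l) * (lam H l * t - (1 - exp (- lam H l * t)))" for H l
  define v where "v H l = a H l / ((lam H l)\<^sup>2 * (b H l) ^ 3) *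
    (lam H l * t - 2 * (1 - exp (- lam H l * t)) + 1 / 2 * (1 - exp (- 2 * lam H l * t)))" for H l
  define \<mu> where "\<mu> H l = (case H of CF \<Rightarrow> \<phi> l | CV \<Rightarrow> \<nu> l) + d H l" for H l
  have Y2: "integrable Q (\<lambda>\<omega>. (Y p \<omega>)\<^sup>2)" for p
  proof -
    have "integrable Q (\<lambda>\<omega>. (I p \<omega>)\<^sup>2) \<longleftrightarrow> integrable Q (\<lambda>\<omega>. (Y p \<omega>)\<^sup>2)"
      by (rule integrable_cong_AE) (use AE_eq[of p] in auto)
    then show ?thesis using M(1)[of "fst p" "snd p"] by (simp add: I_def)
  qed
  have EY: "expectation (Y p) = \<mu> (fst p) (snd p)" for p
  proof -
    have "expectation (Y p) = expectation (I p)"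
      by (rule integral_cong_AE) (use AE_eq[of p] in auto)
    also have "\<dots> = \<mu> (fst p) (snd p)"
      using M(2)[of "fst p" "snd p"] unfolding I_def \<mu>_def d_def
      by (cases "fst p") (simp_all add: x0_def assms(14,15))
    finally show ?thesis .
  qed
  have VY: "expectation (\<lambda>\<omega>. (Y p \<omega>)\<^sup>2) - (expectation (Y p))\<^sup>2 = v (fst p) (snd p)" for p
  proof -
    have "expectation (Y p) = expectation (I p)"
      by (rule integral_cong_AE) (use AE_eq[of p] in auto)
    moreover have "expectation (\<lambda>\<omega>. (Y p \<omega>)\<^sup>2) = expectation (\<lambda>\<omega>. (I p \<omega>)\<^sup>2)"
      by (rule integral_cong_AE) (use AE_eq[of p] in auto)
    ultimately show ?thesis
      using M(3)[of "fst p" "snd p"] unfolding I_def v_def by simp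
  qed

  \<comment> \<open>Entries of the integrated covariance as linear combinations\<close>
  define c where "c k j p = (case fst p of CF \<Rightarrow> if k = j \<and> snd p = k then 1 else 0
    | CV \<Rightarrow> A $ k $ snd p * A $ j $ snd p)" for k j :: 2 and p :: "component \<times> 2"
  have \<sigma>_I: "\<sigma> k j \<omega> = (\<Sum>p\<in>UNIV. c k j p * I p \<omega>)" for k j \<omega>
    using exhaust_2[of k] exhaust_2[of j]
    unfolding assms(11) integrated_covariance_def covariance_nth UNIV_component_2 integrated_def
    by (auto simp: c_def I_def X_def sum_2)
  have rv\<sigma> [measurable]: "random_variable borel (\<sigma> k j)" for k j
    unfolding \<sigma>_I[abs_def] by measurable
  define S where "S k j \<omega> = (\<Sum>p\<in>UNIV. c k j p * Y p \<omega>)" for k j \<omega>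
  have rvS [measurable]: "random_variable borel (S k j)" for k j
    unfolding S_def[abs_def] by measurable
  have \<sigma>_S: "AE \<omega> in Q. \<sigma> k j \<omega> = S k j \<omega>" for k j
  proof -
    have "AE \<omega> in Q. \<forall>p\<in>UNIV. Y p \<omega> = I p \<omega>"
      using AE_eq by (intro AE_finite_allI) (simp_all add: UNIV_component_2)
    then show ?thesis by eventually_elim (auto simp: \<sigma>_I S_def intro!: sum.cong)
  qed
  have fin: "finite (UNIV :: (component \<times> 2) set)"
    by (simp add: UNIV_component_2)
  \<comment> \<open>The variances are rewritten first: their left sides contain the means, and
    rewriting the means beforehand would destroy the pattern.\<close>
  note L = indep_linear_combinations[OF fin indep Y2, unfolded VY, unfolded EY, folded S_def[abs_def]]
  have i1: "integrable Q (\<sigma> k j)" for k j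
    using L(1)[of "c k j"] integrable_cong_AE[OF rv\<sigma> rvS \<sigma>_S, of k j] by (simp add: S_def[abs_def])
  have E1: "expectation (\<sigma> k j) = (\<Sum>p\<in>UNIV. c k j p * \<mu> (fst p) (snd p))" for k j
    using L(2)[of "c k j"] integral_cong_AE[OF rv\<sigma> rvS \<sigma>_S, of k j] by (simp add: S_def[abs_def])
  have SS: "AE \<omega> in Q. \<sigma> k j \<omega> * \<sigma> k' j' \<omega> = S k j \<omega> * S k' j' \<omega>" for k j k' j'
    using \<sigma>_S[of k j] \<sigma>_S[of k' j'] by eventually_elim simp
  have rv2: "random_variable borel (\<lambda>\<omega>. \<sigma> k j \<omega> * \<sigma> k' j' \<omega>)"
    "random_variable borel (\<lambda>\<omega>. S k j \<omega> * S k' j' \<omega>)" for k j k' j'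
    by measurable
  have i2: "integrable Q (\<lambda>\<omega>. \<sigma> k j \<omega> * \<sigma> k' j' \<omega>)" for k j k' j'
    using L(3)[of "c k j" "c k' j'"] integrable_cong_AE[OF rv2 SS] by (simp add: S_def)
  have E2: "expectation (\<lambda>\<omega>. \<sigma> k j \<omega> * \<sigma> k' j' \<omega>) =
      (\<Sum>p\<in>UNIV. c k j p * \<mu> (fst p) (snd p)) * (\<Sum>p\<in>UNIV. c k' j' p * \<mu> (fst p) (snd p)) +
      (\<Sum>p\<in>UNIV. c k j p * c k' j' p * v (fst p) (snd p))" for k j k' j'
    using L(4)[of "c k j" "c k' j'"] integral_cong_AE[OF rv2 SS] by (simp add: S_def)

  \<comment> \<open>Passage to the complex form of the formulas\<close>
  have D: "D H l = \<i> * of_real (d H l)" for H l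
    by (simp add: assms(12) d_def)
  have D2: "D2 H l = - of_real (v H l)" for H l
    by (simp add: assms(13) v_def)
  define m where "m k j = (\<Sum>p\<in>UNIV. c k j p * \<mu> (fst p) (snd p))" for k j
  \<comment> \<open>Each bracket in the claimed formulas is \<open>\<i>\<close> times the real mean
    of an entry, so minus a product of two brackets is the product of the two means.\<close>
  have m_diag: "\<i> * \<phi> k + D CF k + \<i> * (\<Sum>l\<in>UNIV. (A $ k $ l)\<^sup>2 * \<nu> l)
      + (\<Sum>l\<in>UNIV. (A $ k $ l)\<^sup>2 * D CV l) = \<i> * of_real (m k k)" for k
    using exhaust_2[of k]
    by (auto simp: m_def UNIV_component_2 c_def \<mu>_def D sum_2 power2_eq_square algebra_simps)
  have m_off: "\<i> * (\<Sum>l\<in>UNIV. A $ 1 $ l * A $ 2 $ l * \<nu> l)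
      + (\<Sum>l\<in>UNIV. A $ 1 $ l * A $ 2 $ l * D CV l) = \<i> * of_real (m 1 2)"
    by (simp add: m_def UNIV_component_2 c_def \<mu>_def D sum_2 algebra_simps)
  have mean: "expectation (\<sigma> k k) = \<phi> k - \<i> * D CF k + (\<Sum>l\<in>UNIV. (A $ k $ l)\<^sup>2 * \<nu> l)
      - \<i> * (\<Sum>l\<in>UNIV. (A $ k $ l)\<^sup>2 * D CV l)" for k
  proof -
    have "of_real (m k k) = - \<i> * (\<i> * of_real (m k k))" by simp
    then show ?thesis
      unfolding E1 m_def[symmetric] m_diag[symmetric] by (simp add: algebra_simps)
  qed
  have mean_off: "expectation (\<sigma> 1 2) = (\<Sum>l\<in>UNIV. A $ 1 $ l * A $ 2 $ l * \<nu> l)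
      - \<i> * (\<Sum>l\<in>UNIV. A $ 1 $ l * A $ 2 $ l * D CV l)"
  proof -
    have "of_real (m 1 2) = - \<i> * (\<i> * of_real (m 1 2))" by simp
    then show ?thesis
      unfolding E1 m_def[symmetric] m_off[symmetric] by (simp add: algebra_simps)
  qed
  \<comment> \<open>Among the four variance and covariance sums, \<open>F\<close> contributes to
    this one only: the entry with index 1, 2 does not contain \<open>F\<close>, and the two diagonal
    entries contain different coordinates of it.\<close>
  have v_diag: "(\<Sum>p\<in>UNIV. c k k p * c k k p * v (fst p) (snd p)) =
      v CF k + (\<Sum>l\<in>UNIV. (A $ k $ l) ^ 4 * v CV l)" for k
    using exhaust_2[of k]
    by (auto simp: UNIV_component_2 c_def sum_2 power4_eq_xxxx mult_ac)
  have v_off: "(\<Sum>p\<in>UNIV. c 1 2 p * c 1 2 p * v (fst p) (snd p)) =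
      (\<Sum>l\<in>UNIV. (A $ 1 $ l)\<^sup>2 * (A $ 2 $ l)\<^sup>2 * v CV l)"
    by (simp add: UNIV_component_2 c_def sum_2 power2_eq_square mult_ac)
  have v_mix: "(\<Sum>p\<in>UNIV. c k k p * c 1 2 p * v (fst p) (snd p)) =
      (\<Sum>l\<in>UNIV. (A $ k $ l)\<^sup>2 * A $ 1 $ l * A $ 2 $ l * v CV l)" for k
    using exhaust_2[of k]
    by (auto simp: UNIV_component_2 c_def sum_2 power2_eq_square mult_ac)
  have v_12: "(\<Sum>p\<in>UNIV. c 1 1 p * c 2 2 p * v (fst p) (snd p)) =
      (\<Sum>l\<in>UNIV. (A $ 1 $ l)\<^sup>2 * (A $ 2 $ l)\<^sup>2 * v CV l)"
    by (simp add: UNIV_component_2 c_def sum_2 power2_eq_square mult_ac)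
  have ii: "(\<i> * x) * (\<i> * y) = - (x * y)" for x y :: complex
    by (simp add: algebra_simps)
  show ?thesis
    unfolding m_diag m_off power2_eq_square[of "\<sigma> _ _ _"] power2_eq_square[of "\<i> * _"] E2
      v_diag v_off v_mix v_12 m_def[symmetric] ii D2
    by (intro conjI allI i1 i2 mean mean_off) (simp_all add: sum_negf)
qed

end
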